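(* Let $A\in\mathbb R$ and let $E_1,E_2$ be any two distinct entries (flat or non-flat) of the list of band functions of the Mathieu–Hankel operator $\mathbf H(A)$. Then $E_1(k)\neq E_2(k)$ for all $k\in\mathbb R$, and the corresponding spectral bands are disjoint. Moreover, each band function $E$ of $\mathbf H(A)$ is an even $\omega$-periodic function on $\mathbb R$, so that its spectral band equals $\{E(k):k\in\mathbb R\}$.
   Context: Fix $T>0$, $\omega=2\pi/T$. For $A\in\mathbb R$, $\mathbf H(A)$ is the Hankel operator on $L^2(\mathbb R_+)$ with kernel $p_A(\log t)/t$, $p_A(\xi)=A+\operatorname{Re}(\Gamma(1-i\omega)e^{i\omega\xi})$. Its fiber operators are $H(k;A)$ on $\ell^2(\mathbb Z)$ with matrix $[H(k;A)]_{n,m}=\overline{\gamma_n(k)}\,\mathfrak s_{n-m}\,\gamma_m(k)$, $\gamma_n(k)=\Gamma(\frac12+i(\omega n+k))$, $\mathfrak s_0=A$, $\mathfrak s_{\pm1}=\frac12$, $\mathfrak s_j=0$ otherwise. Band functions: the (unique up to ordering) finite or countable list, repetitions allowed, of non-vanishing real analytic real functions on $\mathbb R$ such that for every $k$ the non-zero eigenvalues of $H(k;A)$ with multiplicity are exactly the values of the listed functions at $k$, counted with repetition; flat means constant. The spectral band of a band function $E$ is $\{E(k):k\in[0,\omega/2]\}$. *)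

theory Defs
  imports "HOL-Analysis.Analysis"
begin

text \<open>Mathieu--Hankel fiber operators H(k;A) on l2(Z), with omega = 2 pi / T.\<close>

definition mh_gamma :: "real \<Rightarrow> int \<Rightarrow> real \<Rightarrow> complex" where
  "mh_gamma T n k = Gamma (1/2 + \<i> * complex_of_real (2 * pi / T * real_of_int n + k))"

definition mh_s :: "real \<Rightarrow> int \<Rightarrow> complex" where
  "mh_s A j = (if j = 0 then complex_of_real A else if j = 1 \<or> j = -1 then 1/2 else 0)"

definition mh_entry :: "real \<Rightarrow> real \<Rightarrow> real \<Rightarrow> int \<Rightarrow> int \<Rightarrow> complex" where
  "mh_entry T A k n m = cnj (mh_gamma T n k) * mh_s A (n - m) * mh_gamma T m k"

definition l2seq :: "(int \<Rightarrow> complex) \<Rightarrow> bool" where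
  "l2seq x \<longleftrightarrow> (\<lambda>n. (cmod (x n))\<^sup>2) summable_on UNIV"

definition mh_apply :: "real \<Rightarrow> real \<Rightarrow> real \<Rightarrow> (int \<Rightarrow> complex) \<Rightarrow> int \<Rightarrow> complex" where
  "mh_apply T A k x = (\<lambda>n. \<Sum>\<^sub>\<infinity>m. mh_entry T A k n m * x m)"

definition mh_eigenspace :: "real \<Rightarrow> real \<Rightarrow> real \<Rightarrow> complex \<Rightarrow> (int \<Rightarrow> complex) set" where
  "mh_eigenspace T A k lam = {x. l2seq x \<and> mh_apply T A k x = (\<lambda>n. lam * x n)}"

definition mh_mult :: "real \<Rightarrow> real \<Rightarrow> real \<Rightarrow> complex \<Rightarrow> enat" where
  "mh_mult T A k lam = Sup {enat n | n. \<exists>v :: nat \<Rightarrow> int \<Rightarrow> complex.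
      (\<forall>i<n. v i \<in> mh_eigenspace T A k lam) \<and>
      (\<forall>c :: nat \<Rightarrow> complex. (\<lambda>m. \<Sum>i<n. c i * v i m) = (\<lambda>_. 0) \<longrightarrow> (\<forall>i<n. c i = 0))}"

definition ecount :: "'a set \<Rightarrow> enat" where
  "ecount S = (if finite S then enat (card S) else \<infinity>)"

definition real_analytic :: "(real \<Rightarrow> real) \<Rightarrow> bool" where
  "real_analytic f \<longleftrightarrow> (\<forall>x0. \<exists>r>0. \<exists>a :: nat \<Rightarrow> real.
      \<forall>x. \<bar>x - x0\<bar> < r \<longrightarrow> (\<lambda>n. a n * (x - x0) ^ n) sums f x)"

text \<open>(J, E) is a list (indexed by J, a subset of nat; finite or countable,
  repetitions allowed) of band functions of H(A).\<close>
definition mh_band_list :: "real \<Rightarrow> real \<Rightarrow> nat set \<Rightarrow> (nat \<Rightarrow> real \<Rightarrow> real) \<Rightarrow> bool" where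
  "mh_band_list T A J E \<longleftrightarrow>
     (\<forall>i\<in>J. real_analytic (E i) \<and> (\<forall>k. E i k \<noteq> 0)) \<and>
     (\<forall>k. \<forall>lam :: complex. lam \<noteq> 0 \<longrightarrow>
        ecount {i\<in>J. complex_of_real (E i k) = lam} = mh_mult T A k lam)"

end

theory Submission
  imports Defs "HOL-Complex_Analysis.Cauchy_Integral_Formula"
begin

text \<open>With \<open>y n = \<gamma>\<^sub>n(k) x n\<close>, \<open>\<mu> = \<lambda> / \<pi>\<close> and \<open>|\<gamma>\<^sub>n(k)|\<^sup>2 = \<pi> / cosh (\<pi> (\<omega> n + k))\<close>, the eigenvalue
  equation becomes \<open>y (n + 1) + y (n - 1) = 2 (\<mu> cosh (\<pi> (\<omega> n + k)) - A) y n\<close>. The solution decaying at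
  \<open>+\<infinity>\<close> is a Gaussian times an entire function \<open>\<psi>\<close> of \<open>w = exp (- \<pi> k)\<close> which solves a
  \<open>q\<close>-difference equation with \<open>q = exp (- \<pi> \<omega>)\<close>; reflection gives the one decaying at \<open>-\<infinity>\<close>. Both are
  unique up to scalars, so nonzero eigenvalues are simple, and \<open>\<lambda>\<close> is an eigenvalue of \<open>H(k; A)\<close> iff the
  Casoratian \<open>D(w)\<close> of the two vanishes.

  Suitably normalised, \<open>w\<^sup>2 D(q w) = D(w) = w\<^sup>2 D(1 / w)\<close>. The first identity gives a two-step recurrence for
  the Laurent coefficients of \<open>D\<close>, so such functions form a space of dimension at most two, and one that
  vanishes at two distinct points of \<open>[q\<^sup>1\<^sup>/\<^sup>2, 1]\<close> vanishes identically. Hence an energy \<open>\<lambda>\<close> attained at two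
  points of \<open>[0, \<omega>/2]\<close> is attained everywhere, which by analyticity and countability forces a flat
  band; simplicity then shows that both values belong to that band.

  The symmetries of \<open>D\<close> show that \<open>k \<mapsto> E\<^sub>i(-k)\<close> and \<open>k \<mapsto> E\<^sub>i(k + \<omega>)\<close> are again entries of the list;
  comparing values at \<open>0\<close> and \<open>\<omega>/2\<close> identifies them with \<open>E\<^sub>i\<close>.\<close>

section \<open>A q-difference equation\<close>

text \<open>Since \<epsilon> tends to 0, the coefficients decay faster than every geometric
  sequence; this is what makes the power series \<open>qpsi\<close> entire.\<close>

lemma summable_powser_of_two_step_bound:
  fixes a :: "nat \<Rightarrow> 'a::real_normed_vector"
  assumes bound: "\<And>n. norm (a (Suc (Suc n))) \<le> \<epsilon> n * (norm (a (Suc n)) + norm (a n))"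
    and \<epsilon>: "\<epsilon> \<longlonglongrightarrow> 0" and "R \<ge> 0"
  shows "summable (\<lambda>n. norm (a n) * R ^ n)"
proof -
  \<comment> \<open>A base of at least 1 keeps \<open>norm (a (Suc n)) * S ^ n\<close> below
    \<open>b (Suc n)\<close>.\<close>
  define S where "S = R + 1"
  define b where "b = (\<lambda>n. norm (a n) * S ^ n)"
  have S: "S \<ge> 1" "R \<le> S" using \<open>R \<ge> 0\<close> by (auto simp: S_def)
  have b0: "b n \<ge> 0" for n using S by (simp add: b_def)
  have "eventually (\<lambda>n. \<epsilon> n < 1 / (4 * S\<^sup>2)) sequentially"
    using \<epsilon> S by (intro order_tendstoD) auto
  then obtain N where N: "\<And>n. n \<ge> N \<Longrightarrow> \<epsilon> n < 1 / (4 * S\<^sup>2)"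
    by (auto simp: eventually_sequentially)
  have step: "b (Suc (Suc n)) \<le> (b (Suc n) + b n) / 4" if "n \<ge> N" for n
  proof -
    have "norm (a (Suc (Suc n))) \<le> 1 / (4 * S\<^sup>2) * (norm (a (Suc n)) + norm (a n))"
      by (rule order_trans[OF bound mult_right_mono]) (use N[OF that] in auto)
    hence "b (Suc (Suc n)) \<le> 1 / (4 * S\<^sup>2) * (norm (a (Suc n)) + norm (a n)) * S ^ Suc (Suc n)"
      unfolding b_def by (rule mult_right_mono) (use S in auto)
    also have "\<dots> = (norm (a (Suc n)) * S ^ n + b n) / 4"
      using S by (simp add: b_def power2_eq_square field_simps)
    also have "norm (a (Suc n)) * S ^ n \<le> b (Suc n)"
      unfolding b_def using S by (intro mult_left_mono power_increasing) auto
    finally show ?thesis by simp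
  qed
  \<comment> \<open>The ratio test is applied to this combination because \<open>step\<close>
    involves two earlier terms: the next combination is at most
    \<open>3/4 * b (Suc n) + 1/4 * b n\<close>.\<close>
  have "summable (\<lambda>n. b (Suc n) + b n / 2)"
  proof (rule summable_ratio_test[of "3/4" N])
    fix n assume "n \<ge> N"
    from step[OF this] show "norm (b (Suc (Suc n)) + b (Suc n) / 2) \<le> 3/4 * norm (b (Suc n) + b n / 2)"
      using b0[of n] b0[of "Suc n"] b0[of "Suc (Suc n)"] by simp
  qed auto
  hence "summable (\<lambda>n. b (Suc n))"
    by (rule summable_comparison_test'[of _ 0]) (use b0 in auto)
  hence "summable b" by (simp only: summable_Suc_iff)
  thus ?thesis
    by (rule summable_comparison_test'[of _ 0])
      (use S \<open>R \<ge> 0\<close> in \<open>auto simp: b_def abs_mult intro!: mult_left_mono power_mono\<close>)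
qed

text \<open>Chosen so that the power series \<open>qpsi\<close> satisfies the functional equation \<open>qpsi_rec\<close>.\<close>
fun qcoeff :: "complex \<Rightarrow> complex \<Rightarrow> complex \<Rightarrow> nat \<Rightarrow> complex" where
  "qcoeff q \<alpha> \<gamma> 0 = 1"
| "qcoeff q \<alpha> \<gamma> (Suc 0) = \<alpha> / (1 - q)"
| "qcoeff q \<alpha> \<gamma> (Suc (Suc n)) =
     (\<alpha> * q ^ Suc n * qcoeff q \<alpha> \<gamma> (Suc n) + (q ^ n + \<gamma> * q ^ (2 * n)) * qcoeff q \<alpha> \<gamma> n)
       / (1 - q ^ Suc (Suc n))"

definition qpsi :: "complex \<Rightarrow> complex \<Rightarrow> complex \<Rightarrow> complex \<Rightarrow> complex" where
  "qpsi q \<alpha> \<gamma> w = (\<Sum>n. qcoeff q \<alpha> \<gamma> n * w ^ n)"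

text \<open>Both numerator terms in the recursion carry a factor \<open>q ^ n\<close>, and the
  denominators stay away from 0 by at least \<open>1 - norm q\<close>, so the two-step bound applies
  with a geometric \<epsilon>.\<close>

lemma summable_qcoeff_norm:
  assumes "norm q < 1" "R \<ge> 0"
  shows "summable (\<lambda>n. norm (qcoeff q \<alpha> \<gamma> n) * R ^ n)"
proof (rule summable_powser_of_two_step_bound)
  let ?C = "(norm \<alpha> + 1 + norm \<gamma>) / (1 - norm q)"
  show "(\<lambda>n. ?C * norm q ^ n) \<longlonglongrightarrow> 0"
    using assms by (intro tendsto_mult_right_zero LIMSEQ_realpow_zero) auto
  fix n
  let ?a = "qcoeff q \<alpha> \<gamma>"
  have q1: "norm q ^ m \<le> 1" for m using assms by (simp add: power_le_one)
  have d: "norm (1 - q ^ Suc (Suc n)) \<ge> 1 - norm q"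
  proof -
    have "norm (q ^ Suc (Suc n)) \<le> norm q"
      using mult_left_mono[OF q1[of "Suc n"], of "norm q"] by (simp add: norm_mult norm_power)
    thus ?thesis using norm_triangle_ineq2[of 1 "q ^ Suc (Suc n)"] by simp
  qed
  have 1: "norm (\<alpha> * q ^ Suc n * ?a (Suc n)) \<le> (norm \<alpha> + 1 + norm \<gamma>) * norm q ^ n * norm (?a (Suc n))"
  proof -
    have "norm \<alpha> * norm q ^ Suc n \<le> (norm \<alpha> + 1 + norm \<gamma>) * norm q ^ n"
      using assms by (intro mult_mono power_decreasing) auto
    thus ?thesis by (simp add: norm_mult norm_power mult_right_mono)
  qed
  have 2: "norm ((q ^ n + \<gamma> * q ^ (2 * n)) * ?a n) \<le> (norm \<alpha> + 1 + norm \<gamma>) * norm q ^ n * norm (?a n)"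
  proof -
    have "norm (q ^ n + \<gamma> * q ^ (2 * n)) \<le> norm q ^ n + norm \<gamma> * norm q ^ (2 * n)"
      by (rule order_trans[OF norm_triangle_ineq]) (simp add: norm_mult norm_power)
    also have "\<dots> \<le> norm q ^ n + norm \<gamma> * norm q ^ n"
      using assms by (intro add_left_mono mult_left_mono power_decreasing) auto
    also have "\<dots> = (1 + norm \<gamma>) * norm q ^ n"
      by (simp add: algebra_simps)
    also have "\<dots> \<le> (norm \<alpha> + 1 + norm \<gamma>) * norm q ^ n"
      by (intro mult_right_mono) auto
    finally show ?thesis by (simp add: norm_mult mult_right_mono)
  qed
  have "norm (?a (Suc (Suc n))) \<le>
      ((norm \<alpha> + 1 + norm \<gamma>) * norm q ^ n * norm (?a (Suc n)) + (norm \<alpha> + 1 + norm \<gamma>) * norm q ^ n * norm (?a n))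
        / (1 - norm q)"
    unfolding qcoeff.simps norm_divide
    by (rule frac_le[OF _ order_trans[OF norm_triangle_ineq add_mono[OF 1 2]] _ d])
      (use assms in auto)
  also have "\<dots> = ?C * norm q ^ n * (norm (?a (Suc n)) + norm (?a n))"
    by (simp add: field_simps)
  finally show "norm (?a (Suc (Suc n))) \<le> ?C * norm q ^ n * (norm (?a (Suc n)) + norm (?a n))" .
qed (use assms in auto)

lemma summable_qpsi_norm:
  assumes "norm q < 1"
  shows "summable (\<lambda>n. norm (qcoeff q \<alpha> \<gamma> n * w ^ n))"
  using summable_qcoeff_norm[OF assms, of "norm w"] by (simp add: norm_mult norm_power)

lemma qpsi_sums:
  assumes "norm q < 1"
  shows "(\<lambda>n. qcoeff q \<alpha> \<gamma> n * w ^ n) sums qpsi q \<alpha> \<gamma> w"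
  unfolding qpsi_def
  by (rule summable_sums, rule summable_norm_cancel, rule summable_qpsi_norm[OF assms])

lemma qpsi_0: "qpsi q \<alpha> \<gamma> 0 = 1"
  by (simp add: qpsi_def)

lemma isCont_qpsi:
  assumes "norm q < 1"
  shows "isCont (qpsi q \<alpha> \<gamma>) w"
  unfolding qpsi_def[abs_def]
  by (rule isCont_powser_converges_everywhere)
    (rule sums_summable[OF qpsi_sums[OF assms]])

text \<open>Comparing coefficients of \<open>w ^ n\<close> on both sides gives exactly the recursion
  that defines \<open>qcoeff\<close>, once the term with \<open>q ^ n\<close> is moved to the
  left.\<close>

lemma qpsi_rec:
  assumes "norm q < 1"
  shows "qpsi q \<alpha> \<gamma> w =
    (1 + \<alpha> * w + w\<^sup>2) * qpsi q \<alpha> \<gamma> (q * w) + \<gamma> * w\<^sup>2 * qpsi q \<alpha> \<gamma> (q\<^sup>2 * w)"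
proof -
  let ?a = "qcoeff q \<alpha> \<gamma>"
  \<comment> \<open>The four products on the right as series in w; multiplication by w or w^2 shifts
    indices, and the zero padding aligns them for termwise addition.\<close>
  define c0 where "c0 = (\<lambda>n. ?a n * (q * w) ^ n)"
  define c1 where "c1 = (\<lambda>n. case n of 0 \<Rightarrow> 0 | Suc m \<Rightarrow> \<alpha> * w * (?a m * (q * w) ^ m))"
  define c2 where "c2 = (\<lambda>n. case n of 0 \<Rightarrow> 0 | Suc 0 \<Rightarrow> 0 | Suc (Suc m) \<Rightarrow> w\<^sup>2 * (?a m * (q * w) ^ m))"
  define c3 where "c3 = (\<lambda>n. case n of 0 \<Rightarrow> 0 | Suc 0 \<Rightarrow> 0 | Suc (Suc m) \<Rightarrow> \<gamma> * w\<^sup>2 * (?a m * (q\<^sup>2 * w) ^ m))"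
  have s0: "c0 sums qpsi q \<alpha> \<gamma> (q * w)"
    unfolding c0_def by (rule qpsi_sums[OF assms])
  have "(\<lambda>n. c1 (Suc n)) sums (\<alpha> * w * qpsi q \<alpha> \<gamma> (q * w))"
    unfolding c1_def nat.case by (intro sums_mult qpsi_sums[OF assms])
  hence s1: "c1 sums (\<alpha> * w * qpsi q \<alpha> \<gamma> (q * w))"
    by (subst (asm) sums_Suc_iff) (simp add: c1_def)
  have "(\<lambda>n. c2 (Suc (Suc n))) sums (w\<^sup>2 * qpsi q \<alpha> \<gamma> (q * w))"
    unfolding c2_def nat.case by (intro sums_mult qpsi_sums[OF assms])
  hence s2: "c2 sums (w\<^sup>2 * qpsi q \<alpha> \<gamma> (q * w))"
    by (subst (asm) sums_Suc_iff, subst (asm) sums_Suc_iff) (simp add: c2_def)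
  have "(\<lambda>n. c3 (Suc (Suc n))) sums (\<gamma> * w\<^sup>2 * qpsi q \<alpha> \<gamma> (q\<^sup>2 * w))"
    unfolding c3_def nat.case by (intro sums_mult qpsi_sums[OF assms])
  hence s3: "c3 sums (\<gamma> * w\<^sup>2 * qpsi q \<alpha> \<gamma> (q\<^sup>2 * w))"
    by (subst (asm) sums_Suc_iff, subst (asm) sums_Suc_iff) (simp add: c3_def)
  have nz: "1 - q ^ Suc n \<noteq> 0" for n
  proof
    assume "1 - q ^ Suc n = 0"
    hence "norm (q ^ Suc n) = 1" by simp
    moreover have "norm (q ^ Suc n) < 1"
      unfolding norm_power using assms by (subst power_less_one_iff) auto
    ultimately show False by simp
  qed
  have eq: "c0 n + c1 n + c2 n + c3 n = ?a n * w ^ n" for n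
  proof (rule qcoeff.cases[of "(q, \<alpha>, \<gamma>, n)"])
    fix q' \<alpha>' \<gamma>' assume "(q, \<alpha>, \<gamma>, n) = (q', \<alpha>', \<gamma>', 0)"
    thus ?thesis by (simp add: c0_def c1_def c2_def c3_def)
  next
    fix q' \<alpha>' \<gamma>' assume "(q, \<alpha>, \<gamma>, n) = (q', \<alpha>', \<gamma>', Suc 0)"
    thus ?thesis using nz[of 0] by (simp add: c0_def c1_def c2_def c3_def field_simps)
  next
    fix q' \<alpha>' \<gamma>' m assume "(q, \<alpha>, \<gamma>, n) = (q', \<alpha>', \<gamma>', Suc (Suc m))"
    hence n: "n = Suc (Suc m)" by simp
    define b where "b = ?a n"
    have "?a n * (1 - q ^ n) = \<alpha> * q ^ Suc m * ?a (Suc m) + (q ^ m + \<gamma> * q ^ (2 * m)) * ?a m"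
      using nz[of "Suc m"] unfolding n qcoeff.simps by simp
    hence b: "b = b * q ^ n + \<alpha> * q ^ Suc m * ?a (Suc m) + (q ^ m + \<gamma> * q ^ (2 * m)) * ?a m"
      by (simp add: b_def algebra_simps)
    have "c0 n + c1 n + c2 n + c3 n = 
      (b * q ^ n + \<alpha> * q ^ Suc m * ?a (Suc m) + (q ^ m + \<gamma> * q ^ (2 * m)) * ?a m) * w ^ n"
      unfolding b_def by (simp only: n c0_def c1_def c2_def c3_def nat.case)
        (simp add: power_mult_distrib power_mult power2_eq_square algebra_simps del: qcoeff.simps)
    also have "\<dots> = b * w ^ n" using b by simp
    finally show ?thesis by (simp add: b_def)
  qed
  have "(\<lambda>n. c0 n + c1 n + c2 n + c3 n) sums
    (qpsi q \<alpha> \<gamma> (q * w) + \<alpha> * w * qpsi q \<alpha> \<gamma> (q * w) + w\<^sup>2 * qpsi q \<alpha> \<gamma> (q * w)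
      + \<gamma> * w\<^sup>2 * qpsi q \<alpha> \<gamma> (q\<^sup>2 * w))"
    by (intro sums_add s0 s1 s2 s3)
  from sums_unique2[OF this[unfolded eq] qpsi_sums[OF assms]]
  show ?thesis by (simp add: algebra_simps)
qed

text \<open>Up to an elementary factor, the Casoratian of the solutions decaying at \<open>+\<infinity>\<close> and \<open>-\<infinity>\<close>
  (see \<open>jost_casoratian\<close>).\<close>
definition qdet :: "complex \<Rightarrow> complex \<Rightarrow> complex \<Rightarrow> complex \<Rightarrow> complex" where
  "qdet q \<alpha> \<gamma> w = qpsi q \<alpha> \<gamma> w * qpsi q \<alpha> \<gamma> (q / w)
     + \<gamma> * qpsi q \<alpha> \<gamma> (q * w) * qpsi q \<alpha> \<gamma> (q\<^sup>2 / w)"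

text \<open>The polynomial 1 + \<alpha> w + w^2 is palindromic, so w^2 times \<open>qpsi_rec\<close>
  at 1/w has the same polynomial as \<open>qpsi_rec\<close> at w. Using the first to expand the left
  side and the second to contract it gives the right side.\<close>

lemma qdet_shift:
  assumes "norm q < 1" "w \<noteq> 0" "q \<noteq> 0"
  shows "w\<^sup>2 * qdet q \<alpha> \<gamma> (q * w) = qdet q \<alpha> \<gamma> w"
proof -
  let ?p = "qpsi q \<alpha> \<gamma>"
  have "w\<^sup>2 * ?p (1 / w) = w\<^sup>2 * ((1 + \<alpha> * (1/w) + (1/w)\<^sup>2) * ?p (q * (1/w)) + \<gamma> * (1/w)\<^sup>2 * ?p (q\<^sup>2 * (1/w)))"
    by (subst qpsi_rec[OF assms(1)]) (rule refl)
  also have "\<dots> = (1 + \<alpha> * w + w\<^sup>2) * ?p (q / w) + \<gamma> * ?p (q\<^sup>2 / w)"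
    using assms by (simp add: field_simps power2_eq_square)
  finally have 1: "w\<^sup>2 * ?p (1 / w) = (1 + \<alpha> * w + w\<^sup>2) * ?p (q / w) + \<gamma> * ?p (q\<^sup>2 / w)" .
  have a: "q / (q * w) = 1 / w" "q\<^sup>2 / (q * w) = q / w" "q * (q * w) = q\<^sup>2 * w"
    using assms by (simp_all add: field_simps power2_eq_square)
  have "w\<^sup>2 * qdet q \<alpha> \<gamma> (q * w) = ?p (q * w) * (w\<^sup>2 * ?p (1 / w)) + \<gamma> * w\<^sup>2 * ?p (q\<^sup>2 * w) * ?p (q / w)"
    unfolding qdet_def a by (simp add: algebra_simps)
  also have "\<dots> = ?p (q / w) * ((1 + \<alpha> * w + w\<^sup>2) * ?p (q * w) + \<gamma> * w\<^sup>2 * ?p (q\<^sup>2 * w))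
      + \<gamma> * ?p (q * w) * ?p (q\<^sup>2 / w)"
    unfolding 1 by (simp add: algebra_simps)
  also have "\<dots> = qdet q \<alpha> \<gamma> w"
    unfolding qdet_def qpsi_rec[OF assms(1), of \<alpha> \<gamma> w, symmetric] by (simp add: mult.commute)
  finally show ?thesis .
qed

text \<open>Passing from q w to 1/w only swaps the two factors in each product of
  \<open>qdet\<close>, so this is \<open>qdet_shift\<close> again.\<close>

lemma qdet_inverse:
  assumes "norm q < 1" "w \<noteq> 0" "q \<noteq> 0"
  shows "w\<^sup>2 * qdet q \<alpha> \<gamma> (1 / w) = qdet q \<alpha> \<gamma> w"
proof -
  have "qdet q \<alpha> \<gamma> (1 / w) = qdet q \<alpha> \<gamma> (q * w)"
    using assms by (simp add: qdet_def power2_eq_square mult.assoc mult.commute mult.left_commute)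
  thus ?thesis using qdet_shift[OF assms] by simp
qed

section \<open>Laurent series on the punctured plane\<close>

lemma powser_zero_imp_coeffs_zero:
  fixes a :: "nat \<Rightarrow> 'a::{real_normed_field,banach}"
  assumes "r > 0" and zero: "\<And>x. norm (x - \<xi>) < r \<Longrightarrow> (\<lambda>n. a n * (x - \<xi>) ^ n) sums 0"
  shows "a n = 0"
proof (rule ccontr)
  assume n: "a n \<noteq> 0"
  have "(\<lambda>n. a n * 0 ^ n) sums 0" using zero[of \<xi>] \<open>r > 0\<close> by simp
  hence "a 0 = 0" using powser_sums_zero_iff by blast
  with n have "n > 0" by (cases n) auto
  from powser_0_nonzero[of r \<xi> a "\<lambda>_. 0", OF \<open>r > 0\<close> zero refl n this]
  obtain s where "s > 0" and s: "\<And>z. z \<in> cball \<xi> s - {\<xi>} \<Longrightarrow> (0::'a) \<noteq> 0" by metis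
  have "\<xi> + of_real s \<in> cball \<xi> s - {\<xi>}" using \<open>s > 0\<close> by (simp add: dist_norm)
  from s[OF this] show False by simp
qed

text \<open>The part with nonnegative powers is entire, and being minus the negative part it tends
  to 0 at infinity; by Liouville it vanishes, and then so does the rest.\<close>

lemma laurent_series_zero_imp_coeffs_zero:
  fixes d :: "int \<Rightarrow> complex"
  assumes zero: "\<And>w. w \<noteq> 0 \<Longrightarrow> ((\<lambda>n. d n * w powi n) has_sum 0) UNIV"
  shows "d n = 0"
proof -
  \<comment> \<open>The coefficient \<open>d 0\<close> belongs to both \<open>F\<close> and
    \<open>G\<close>; this is why the relation below reads
    \<open>F w = d 0 - G (1 / w)\<close>.\<close>
  define F where "F = (\<lambda>w. \<Sum>n. d (int n) * w ^ n)"
  define G where "G = (\<lambda>w. \<Sum>n. d (- int n) * w ^ n)"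
  have summF: "((\<lambda>n. d (int n) * w ^ n) has_sum (\<Sum>\<^sub>\<infinity>n\<in>{0..}. d n * w powi n)) UNIV" if "w \<noteq> 0" for w
  proof -
    have "(\<lambda>n. d n * w powi n) summable_on {0..}"
      by (rule summable_on_subset_banach[OF has_sum_imp_summable[OF zero[OF that]]]) auto
    hence "((\<lambda>n. d n * w powi n) has_sum (\<Sum>\<^sub>\<infinity>n\<in>{0..}. d n * w powi n)) {0..}"
      by (rule has_sum_infsum)
    thus ?thesis
      by (subst has_sum_reindex_bij_witness[of _ nat int "{0..}"]) auto
  qed
  have summG: "((\<lambda>n. d (- int n) * (1 / w) ^ n) has_sum (\<Sum>\<^sub>\<infinity>n\<in>{..0}. d n * w powi n)) UNIV" if "w \<noteq> 0" for w
  proof -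
    have "(\<lambda>n. d n * w powi n) summable_on {..0}"
      by (rule summable_on_subset_banach[OF has_sum_imp_summable[OF zero[OF that]]]) auto
    hence "((\<lambda>n. d n * w powi n) has_sum (\<Sum>\<^sub>\<infinity>n\<in>{..0}. d n * w powi n)) {..0}"
      by (rule has_sum_infsum)
    thus ?thesis
      by (subst has_sum_reindex_bij_witness[of _ "\<lambda>n. nat (- n)" "\<lambda>n. - int n" "{..0}"])
        (auto simp: power_int_minus power_one_over inverse_eq_divide)
  qed
  have sF: "summable (\<lambda>n. d (int n) * w ^ n)" for w
  proof (cases "w = 0")
    case False
    thus ?thesis using summF[OF False] by (blast dest: has_sum_imp_sums sums_summable)
  next
    case True
    thus ?thesis by (auto intro: sums_summable[OF powser_sums_zero])
  qed
  have sG: "summable (\<lambda>n. d (- int n) * w ^ n)" for w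
  proof (cases "w = 0")
    case False
    thus ?thesis using summG[of "1 / w"] by (auto dest: has_sum_imp_sums sums_summable)
  next
    case True
    thus ?thesis by (auto intro: sums_summable[OF powser_sums_zero])
  qed
  have FG: "F w = d 0 - G (1 / w)" if w: "w \<noteq> 0" for w
  proof -
    have F: "F w = (\<Sum>\<^sub>\<infinity>n\<in>{0..}. d n * w powi n)"
      unfolding F_def using has_sum_imp_sums[OF summF[OF w]] by (simp add: sums_iff)
    have G: "G (1 / w) = (\<Sum>\<^sub>\<infinity>n\<in>{..0}. d n * w powi n)"
      unfolding G_def using has_sum_imp_sums[OF summG[OF w]] by (simp add: sums_iff)
    have s: "(\<lambda>n. d n * w powi n) summable_on B" for B
      by (rule summable_on_subset_banach[OF has_sum_imp_summable[OF zero[OF w]]]) auto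
    have "0 = (\<Sum>\<^sub>\<infinity>n. d n * w powi n)"
      using infsumI[OF zero[OF w]] by simp
    also have "(UNIV :: int set) = {0..} \<union> {..<0}" by auto
    also have "(\<Sum>\<^sub>\<infinity>n\<in>{0..} \<union> {..<0}. d n * w powi n) =
        (\<Sum>\<^sub>\<infinity>n\<in>{0..}. d n * w powi n) + (\<Sum>\<^sub>\<infinity>n\<in>{..<0}. d n * w powi n)"
      by (rule infsum_Un_disjoint[OF s s]) auto
    finally have 1: "0 = F w + (\<Sum>\<^sub>\<infinity>n\<in>{..<0}. d n * w powi n)" using F by simp
    have "{..0::int} = {0} \<union> {..<0}" by auto
    hence "G (1 / w) = (\<Sum>\<^sub>\<infinity>n\<in>{0} \<union> {..<0}. d n * w powi n)" using G by simp
    also have "\<dots> = (\<Sum>\<^sub>\<infinity>n\<in>{0}. d n * w powi n) + (\<Sum>\<^sub>\<infinity>n\<in>{..<0}. d n * w powi n)"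
      by (rule infsum_Un_disjoint[OF s s]) auto
    finally show ?thesis using 1 by (simp add: eq_neg_iff_add_eq_0 algebra_simps)
  qed
  have "isCont G 0" unfolding G_def by (rule isCont_powser_converges_everywhere[OF sG])
  hence "(G \<longlongrightarrow> G 0) (at 0)" by (simp add: isCont_def)
  hence "((\<lambda>w. d 0 - G (inverse w)) \<longlongrightarrow> d 0 - G 0) at_infinity"
    by (intro tendsto_diff tendsto_const filterlim_compose[of G _ "at 0" inverse])
      (auto simp only: filterlim_inverse_at_iff filterlim_ident)
  moreover have "G 0 = d 0" by (simp add: G_def)
  ultimately have "((\<lambda>w. d 0 - G (1 / w)) \<longlongrightarrow> 0) at_infinity"
    by (simp add: inverse_eq_divide)
  moreover have "eventually (\<lambda>w::complex. w \<noteq> 0) at_infinity"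
    by (auto simp: eventually_at_infinity intro!: exI[of _ 1])
  hence "eventually (\<lambda>w. d 0 - G (1 / w) = F w) at_infinity"
    by eventually_elim (simp add: FG)
  ultimately have "(F \<longlongrightarrow> 0) at_infinity"
    by (simp add: tendsto_cong)
  moreover have "F holomorphic_on UNIV"
    unfolding F_def holomorphic_on_def field_differentiable_def
    using termdiffs_strong_converges_everywhere[OF sF] by (auto intro: has_field_derivative_at_within)
  ultimately have F0: "F w = 0" for w by (intro Liouville_weak_0)
  have d_nonneg: "d (int m) = 0" for m
    by (rule powser_zero_imp_coeffs_zero[of 1 0 "\<lambda>n. d (int n)"])
      (use F0 sF in \<open>auto simp: F_def sums_iff\<close>)
  have G0: "G w = 0" for w
    using FG[of "1 / w"] F0 d_nonneg[of 0] \<open>G 0 = d 0\<close> by (cases "w = 0") auto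
  have d_nonpos: "d (- int m) = 0" for m
    by (rule powser_zero_imp_coeffs_zero[of 1 0 "\<lambda>n. d (- int n)"])
      (use G0 sG in \<open>auto simp: G_def sums_iff\<close>)
  show ?thesis
    by (cases n rule: int_cases2) (use d_nonneg d_nonpos in auto)
qed

text \<open>The \<open>n\<close>-th Laurent coefficient of \<open>f(w) g(1/w)\<close> collects the index pairs with difference \<open>n\<close>.\<close>
lemma laurent_series_of_product:
  fixes a b :: "nat \<Rightarrow> complex"
  assumes summable_a: "\<And>w. summable (\<lambda>i. norm (a i * w ^ i))"
    and summable_b: "\<And>w. summable (\<lambda>i. norm (b i * w ^ i))"
  shows "\<exists>d. \<forall>w. w \<noteq> 0 \<longrightarrow>
     ((\<lambda>n. d n * w powi n) has_sum ((\<Sum>i. a i * w ^ i) * (\<Sum>j. b j * (1 / w) ^ j))) UNIV"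
proof (intro exI allI impI)
  fix w :: complex
  assume w: "w \<noteq> 0"
  note sa = summable_a[of w] and sb = summable_b[of "1 / w"]
  define S where "S = (\<lambda>n. {(i, j). int i - int j = n})"
  let ?f = "\<lambda>(i, j). (a i * w ^ i) * (b j * (1 / w) ^ j)"
  let ?P = "(\<Sum>i. a i * w ^ i) * (\<Sum>j. b j * (1 / w) ^ j)"
  have ha: "((\<lambda>i. a i * w ^ i) has_sum (\<Sum>i. a i * w ^ i)) UNIV"
    by (rule norm_summable_imp_has_sum[OF sa summable_sums[OF summable_norm_cancel[OF sa]]])
  have hb: "((\<lambda>j. b j * (1 / w) ^ j) has_sum (\<Sum>j. b j * (1 / w) ^ j)) UNIV"
    by (rule norm_summable_imp_has_sum[OF sb summable_sums[OF summable_norm_cancel[OF sb]]])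
  \<comment> \<open>Absolute summability over all index pairs justifies regrouping the double sum by
    the difference of the indices.\<close>
  have "(\<lambda>ij. norm (?f ij)) summable_on (UNIV \<times> UNIV)"
  proof (rule summable_on_SigmaI)
    fix i
    have "((\<lambda>j. norm (b j * (1 / w) ^ j)) has_sum (\<Sum>j. norm (b j * (1 / w) ^ j))) UNIV"
      by (rule sums_nonneg_imp_has_sum[OF summable_sums[OF sb]]) auto
    from has_sum_cmult_right[OF this, of "norm (a i * w ^ i)"]
    show "((\<lambda>j. norm (?f (i, j))) has_sum (norm (a i * w ^ i) * (\<Sum>j. norm (b j * (1 / w) ^ j)))) UNIV"
      by (simp add: norm_mult)
  next
    show "(\<lambda>i. norm (a i * w ^ i) * (\<Sum>j. norm (b j * (1 / w) ^ j))) summable_on UNIV"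
      by (intro summable_on_cmult_left summable_nonneg_imp_summable_on sa) auto
  qed auto
  hence summ: "?f summable_on (UNIV \<times> UNIV)"
    by (rule abs_summable_summable)
  have prod: "(?f has_sum ?P) (UNIV \<times> UNIV)"
  proof (rule has_sum_SigmaI[OF _ _ summ])
    fix i
    show "((\<lambda>j. ?f (i, j)) has_sum (a i * w ^ i * (\<Sum>j. b j * (1 / w) ^ j))) UNIV"
      using has_sum_cmult_right[OF hb, of "a i * w ^ i"] by simp
  qed (rule has_sum_cmult_left[OF ha])
  have re: "((\<lambda>(n, ij). ?f ij) has_sum ?P) (Sigma UNIV S)"
    using prod
    by (subst has_sum_reindex_bij_witness[of _ "\<lambda>(i, j). (int i - int j, (i, j))" snd "UNIV \<times> UNIV"])
      (auto simp: S_def)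
  have trm: "?f ij = (case ij of (i, j) \<Rightarrow> a i * b j) * w powi n" if "ij \<in> S n" for n ij
  proof (cases ij)
    case (Pair i j)
    hence "n = int i - int j" using that by (simp add: S_def)
    hence "w powi n = w ^ i * (1 / w) ^ j"
      using w by (simp add: power_int_diff power_one_over)
    thus ?thesis using Pair by simp
  qed
  show "((\<lambda>n. (\<Sum>\<^sub>\<infinity>(i, j) \<in> {(i, j). int i - int j = n}. a i * b j) * w powi n) has_sum ?P) UNIV"
  proof (rule has_sum_SigmaD[OF re])
    fix n
    have "?f summable_on S n"
      by (rule summable_on_subset_banach[OF summ]) auto
    hence "(\<lambda>ij. (case ij of (i, j) \<Rightarrow> a i * b j) * w powi n) summable_on S n"
      by (subst (asm) summable_on_cong[OF trm]) auto
    hence "(\<lambda>ij. (case ij of (i, j) \<Rightarrow> a i * b j)) summable_on S n"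
      using w by (subst (asm) summable_on_cmult_left') auto
    hence "((\<lambda>ij. (case ij of (i, j) \<Rightarrow> a i * b j)) has_sum (\<Sum>\<^sub>\<infinity>(i, j) \<in> S n. a i * b j)) (S n)"
      by (rule has_sum_infsum)
    hence "((\<lambda>ij. (case ij of (i, j) \<Rightarrow> a i * b j) * w powi n) has_sum
        (\<Sum>\<^sub>\<infinity>(i, j) \<in> S n. a i * b j) * w powi n) (S n)"
      by (rule has_sum_cmult_left)
    thus "((\<lambda>ij. case (n, ij) of (n, ij) \<Rightarrow> ?f ij) has_sum
        (\<Sum>\<^sub>\<infinity>(i, j) \<in> {(i, j). int i - int j = n}. a i * b j) * w powi n) (S n)"
      unfolding prod.case by (subst has_sum_cong[OF trm]) (auto simp: S_def)
  qed
qed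

section \<open>Zeros of the determinant\<close>

text \<open>Each product in \<open>qdet\<close> is a power series in w times one in 1/w. Comparing
  coefficients in \<open>qdet_shift\<close>, divided by w^2, yields the recurrence.\<close>

lemma qdet_laurent:
  assumes "norm q < 1" "q \<noteq> 0"
  obtains d where "\<And>w. w \<noteq> 0 \<Longrightarrow> ((\<lambda>n. d n * w powi n) has_sum qdet q \<alpha> \<gamma> w) UNIV"
    and "\<And>n. d (n + 2) = q powi n * d n"
proof -
  let ?a = "qcoeff q \<alpha> \<gamma>" and ?p = "qpsi q \<alpha> \<gamma>"
  \<comment> \<open>The dilations \<open>qpsi (z * w)\<close> are absorbed into rescaled
    coefficients, so that \<open>laurent_series_of_product\<close> applies.\<close>
  have eq: "(\<lambda>i. ?a i * z ^ i * w ^ i) = (\<lambda>i. ?a i * (z * w) ^ i)" for z w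
    by (simp add: power_mult_distrib mult_ac)
  have sm: "summable (\<lambda>i. norm (?a i * z ^ i * w ^ i))" for z w
    using summable_qpsi_norm[OF assms(1), of \<alpha> \<gamma> "z * w"] by (simp add: power_mult_distrib mult_ac)
  obtain d1 where d1: "\<And>w. w \<noteq> 0 \<Longrightarrow> ((\<lambda>n. d1 n * w powi n) has_sum
      ((\<Sum>i. ?a i * 1 ^ i * w ^ i) * (\<Sum>j. ?a j * q ^ j * (1 / w) ^ j))) UNIV"
    using laurent_series_of_product[OF sm sm, of 1 q] by blast
  obtain d2 where d2: "\<And>w. w \<noteq> 0 \<Longrightarrow> ((\<lambda>n. d2 n * w powi n) has_sum
      ((\<Sum>i. ?a i * q ^ i * w ^ i) * (\<Sum>j. ?a j * (q\<^sup>2) ^ j * (1 / w) ^ j))) UNIV"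
    using laurent_series_of_product[OF sm sm, of q "q\<^sup>2"] by blast
  define d where "d = (\<lambda>n. d1 n + \<gamma> * d2 n)"
  have d: "((\<lambda>n. d n * w powi n) has_sum qdet q \<alpha> \<gamma> w) UNIV" if "w \<noteq> 0" for w
    using has_sum_add[OF d1[OF that] has_sum_cmult_right[OF d2[OF that], of \<gamma>]]
    unfolding eq qpsi_def[symmetric] d_def qdet_def by (simp add: algebra_simps)
  have "d (n + 2) - q powi n * d n = 0" for n
  proof (rule laurent_series_zero_imp_coeffs_zero)
    fix w :: complex assume w: "w \<noteq> 0"
    have "((\<lambda>n. d n * w powi (n - 2)) has_sum (qdet q \<alpha> \<gamma> w / w\<^sup>2)) UNIV"
      using has_sum_cmult_right[OF d[OF w], of "1 / w\<^sup>2"] w by (simp add: power_int_diff)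
    hence 1: "((\<lambda>n. d (n + 2) * w powi n) has_sum (qdet q \<alpha> \<gamma> w / w\<^sup>2)) UNIV"
      by (subst has_sum_reindex_bij_witness[of _ "\<lambda>n. n - 2" "\<lambda>n. n + 2" UNIV]) auto
    have 2: "((\<lambda>n. d n * (q * w) powi n) has_sum qdet q \<alpha> \<gamma> (q * w)) UNIV"
      using w assms by (intro d) auto
    have "qdet q \<alpha> \<gamma> w / w\<^sup>2 = qdet q \<alpha> \<gamma> (q * w)"
      using qdet_shift[OF assms(1) w assms(2), of \<alpha> \<gamma>] w by (simp add: field_simps)
    with has_sum_add[OF 1 has_sum_cmult_right[OF 2, of "- 1"]]
    show "((\<lambda>n. (d (n + 2) - q powi n * d n) * w powi n) has_sum 0) UNIV"
      by (simp add: power_int_mult_distrib algebra_simps)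
  qed
  hence "d (n + 2) = q powi n * d n" for n by simp
  thus ?thesis using that d by blast
qed

lemma two_step_recurrence_zero:
  fixes d :: "int \<Rightarrow> 'a::field"
  assumes rec: "\<And>n. d (n + 2) = c n * d n" and "\<And>n. c n \<noteq> 0" and "d 0 = 0" "d 1 = 0"
  shows "d n = 0"
proof -
  have "d n = 0 \<and> d (n + 1) = 0"
  proof (induction n rule: int_induct[of _ 0])
    case base thus ?case using assms by simp
  next
    case (step1 i) thus ?case using rec[of i] by (simp add: add.assoc)
  next
    case (step2 i)
    have "d (i + 1) = c (i - 1) * d (i - 1)" using rec[of "i - 1"] by (simp add: add.commute)
    thus ?case using step2 assms(2)[of "i - 1"] by simp
  qed
  thus ?thesis by simp
qed

text \<open>The functions \<open>qdet q \<alpha> \<gamma>\<close> are determined by two Laurent coefficients, hence span a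
  space of dimension at most two; \<open>f1\<close> and \<open>f2\<close> are a basis dual to evaluation at \<open>w1\<close> and \<open>w2\<close>.\<close>
lemma qdet_eq_zero_if_two_zeros:
  assumes q: "norm q < 1" "q \<noteq> 0"
    and f1: "f1 = qdet q \<alpha>1 \<gamma>1" "f1 w1 = 0" "f1 w2 \<noteq> 0"
    and f2: "f2 = qdet q \<alpha>2 \<gamma>2" "f2 w2 = 0" "f2 w1 \<noteq> 0"
    and w: "w1 \<noteq> 0" "w2 \<noteq> 0" "w \<noteq> 0"
    and zeros: "qdet q \<alpha> \<gamma> w1 = 0" "qdet q \<alpha> \<gamma> w2 = 0"
  shows "qdet q \<alpha> \<gamma> w = 0"
proof -
  obtain d where d: "\<And>w. w \<noteq> 0 \<Longrightarrow> ((\<lambda>n. d n * w powi n) has_sum qdet q \<alpha> \<gamma> w) UNIV"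
    "\<And>n. d (n + 2) = q powi n * d n" by (rule qdet_laurent[OF q]) blast
  obtain a where a: "\<And>w. w \<noteq> 0 \<Longrightarrow> ((\<lambda>n. a n * w powi n) has_sum f1 w) UNIV"
    "\<And>n. a (n + 2) = q powi n * a n" unfolding f1(1) by (rule qdet_laurent[OF q]) blast
  obtain b where b: "\<And>w. w \<noteq> 0 \<Longrightarrow> ((\<lambda>n. b n * w powi n) has_sum f2 w) UNIV"
    "\<And>n. b (n + 2) = q powi n * b n" unfolding f2(1) by (rule qdet_laurent[OF q]) blast
  \<comment> \<open>All three coefficient sequences obey the same recurrence, so a linear relation
    between their entries at 0 and 1 extends to the functions.\<close>
  have dep: "x * qdet q \<alpha> \<gamma> w + y * f1 w + z * f2 w = 0"
    if "x * d 0 + y * a 0 + z * b 0 = 0" "x * d 1 + y * a 1 + z * b 1 = 0" "w \<noteq> 0" for x y z w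
  proof -
    let ?c = "\<lambda>n. x * d n + y * a n + z * b n"
    have c0: "?c n = 0" for n
      by (rule two_step_recurrence_zero[where d = ?c and c = "\<lambda>n. q powi n"])
        (use that q in \<open>auto simp: d a b algebra_simps\<close>)
    have "((\<lambda>n. x * (d n * w powi n) + y * (a n * w powi n) + z * (b n * w powi n)) has_sum
        (x * qdet q \<alpha> \<gamma> w + y * f1 w + z * f2 w)) UNIV"
      by (intro has_sum_add has_sum_cmult_right d a b that)
    also have "(\<lambda>n. x * (d n * w powi n) + y * (a n * w powi n) + z * (b n * w powi n)) = (\<lambda>n. ?c n * w powi n)"
      by (simp add: algebra_simps)
    also have "\<dots> = (\<lambda>_. 0)" using c0 by simp
    finally show ?thesis using has_sum_unique[OF _ has_sum_0] by auto
  qed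
  \<comment> \<open>If this determinant vanished, the coefficient vectors of \<open>f1\<close> and
    \<open>f2\<close> would be parallel, contradicting their values at \<open>w1\<close> and
    \<open>w2\<close>. Cramer's rule then expresses \<open>qdet\<close> through \<open>f1\<close>
    and \<open>f2\<close>.\<close>
  let ?\<Delta> = "a 0 * b 1 - a 1 * b 0"
  have "?\<Delta> \<noteq> 0"
  proof
    assume \<Delta>: "?\<Delta> = 0"
    have "b 0 * f1 w2 - a 0 * f2 w2 = 0"
      using dep[of 0 "b 0" "- a 0" w2] \<Delta> w by (simp add: algebra_simps)
    hence b0: "b 0 = 0" using f1 f2 by simp
    have "b 1 * f1 w2 - a 1 * f2 w2 = 0"
      using dep[of 0 "b 1" "- a 1" w2] \<Delta> w by (simp add: algebra_simps)
    hence "b 1 = 0" using f1 f2 by simp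
    thus False using dep[of 0 0 1 w1] b0 w f2 by simp
  qed
  have D: "?\<Delta> * qdet q \<alpha> \<gamma> w - (d 0 * b 1 - d 1 * b 0) * f1 w - (a 0 * d 1 - a 1 * d 0) * f2 w = 0"
    if "w \<noteq> 0" for w
    using dep[of ?\<Delta> "- (d 0 * b 1 - d 1 * b 0)" "- (a 0 * d 1 - a 1 * d 0)" w] that
    by (simp add: algebra_simps)
  have "a 0 * d 1 - a 1 * d 0 = 0" using D[of w1] w f1 f2 zeros by simp
  moreover have "d 0 * b 1 - d 1 * b 0 = 0" using D[of w2] w f1 f2 zeros by simp
  ultimately show ?thesis using D[of w] \<open>?\<Delta> \<noteq> 0\<close> w by simp
qed

section \<open>Reference functions with a prescribed zero\<close>

lemma qpsi_power_tendsto_1: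
  assumes "norm q < 1"
  shows "(\<lambda>n. qpsi q \<alpha> \<gamma> (q ^ n * w)) \<longlonglongrightarrow> 1"
proof -
  have "(\<lambda>n. q ^ n * w) \<longlonglongrightarrow> 0 * w"
    by (intro tendsto_mult tendsto_const LIMSEQ_power_zero assms)
  hence "(\<lambda>n. qpsi q \<alpha> \<gamma> (q ^ n * w)) \<longlonglongrightarrow> qpsi q \<alpha> \<gamma> 0"
    by (intro isCont_tendsto_compose[OF isCont_qpsi[OF assms]]) simp
  thus ?thesis by (simp add: qpsi_0)
qed

text \<open>For \<open>\<gamma> = 0\<close> the recurrence iterates to an explicit product, which locates all zeros.\<close>
lemma qpsi_factor:
  assumes "norm q < 1" "a \<noteq> 0"
  shows "qpsi q (- (a + 1 / a)) 0 w = (1 - a * w) * (1 - w / a) * qpsi q (- (a + 1 / a)) 0 (q * w)"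
  by (subst qpsi_rec[OF assms(1)]) (use assms in \<open>simp add: field_simps power2_eq_square\<close>)

text \<open>If no linear factor vanished along the orbit \<open>q ^ n * w\<close>, the zero would
  propagate along it towards the origin, where \<open>qpsi\<close> equals 1.\<close>

lemma qpsi_factor_zeroD:
  assumes q: "norm q < 1" and a: "a \<noteq> 0" and zero: "qpsi q (- (a + 1 / a)) 0 w = 0"
  shows "\<exists>n. q ^ n * w = a \<or> q ^ n * w = 1 / a"
proof (rule ccontr)
  assume no: "\<not> ?thesis"
  have "qpsi q (- (a + 1 / a)) 0 (q ^ n * w) = 0" for n
  proof (induction n)
    case (Suc n)
    have "1 - a * (q ^ n * w) \<noteq> 0" "1 - q ^ n * w / a \<noteq> 0"
      using no a by (auto simp: field_simps)
    with Suc show ?case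
      using qpsi_factor[OF q a, of "q ^ n * w"] a by (auto simp: mult.assoc)
  qed (use zero in simp)
  hence "(\<lambda>n. 0) \<longlonglongrightarrow> (1::complex)"
    using qpsi_power_tendsto_1[OF q, of "- (a + 1 / a)" 0 w] by simp
  thus False using LIMSEQ_unique[OF tendsto_const] by fastforce
qed

text \<open>The value \<alpha> = -(a + 1/a) makes 1 + \<alpha> w + w^2 vanish at a, which places a
  zero of the reference function at the prescribed point.\<close>

lemma qdet_reference_zero:
  assumes "norm q < 1" "a \<noteq> 0"
  shows "qdet q (- (a + 1 / a)) 0 a = 0"
  using qpsi_factor[OF assms, of a] assms by (simp add: qdet_def)

text \<open>The zeros are the points \<open>r powi n * a\<close> and \<open>r powi n / a\<close>.
  The interval from \<open>sqrt r\<close> to 1 is a fundamental domain for multiplication by r and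
  inversion, so it contains no zero besides a.\<close>

lemma qdet_reference_nonzero:
  fixes r a w :: real
  assumes r: "0 < r" "r < 1" and a: "0 < a" "a \<le> 1" "r \<le> a\<^sup>2" and w: "0 < w" "w \<le> 1" "r \<le> w\<^sup>2"
    and "a \<noteq> w"
  shows "qdet (of_real r) (- (of_real a + 1 / of_real a)) 0 (of_real w) \<noteq> 0"
proof
  let ?p = "qpsi (of_real r) (- (of_real a + 1 / of_real a)) 0"
  have q: "norm (complex_of_real r) < 1" "complex_of_real a \<noteq> 0" using r a by auto
  have zeroD: "\<exists>n. r ^ n * t = a \<or> r ^ n * t = 1 / a" if "?p (of_real t) = 0" for t
  proof -
    from qpsi_factor_zeroD[OF q that] obtain n where
      "complex_of_real (r ^ n * t) = of_real a \<or> complex_of_real (r ^ n * t) = of_real (1 / a)"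
      by auto
    thus ?thesis unfolding of_real_eq_iff by blast
  qed
  \<comment> \<open>This excludes \<open>r ^ n * w = a\<close> for positive n, where the left side
    is at most r.\<close>
  have ra: "r < a"
  proof (rule ccontr)
    assume "\<not> r < a"
    hence "a * a \<le> r * r" using a by (intro mult_mono) auto
    also have "\<dots> < r * 1" using r by (intro mult_strict_left_mono) auto
    finally show False using a by (simp add: power2_eq_square)
  qed
  assume "qdet (of_real r) (- (of_real a + 1 / of_real a)) 0 (of_real w) = 0"
  hence "?p (of_real w) = 0 \<or> ?p (of_real (r / w)) = 0" by (simp add: qdet_def)
  thus False
  proof
    assume "?p (of_real w) = 0"
    then obtain n where n: "r ^ n * w = a \<or> r ^ n * w = 1 / a" using zeroD by blast
    have n0: "n \<noteq> 0 \<Longrightarrow> r ^ n * w \<le> r"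
    proof -
      assume "n \<noteq> 0"
      hence "r ^ n \<le> r ^ 1" using r by (intro power_decreasing) auto
      hence "r ^ n * w \<le> r * 1" using r w by (intro mult_mono) auto
      thus ?thesis by simp
    qed
    have a1: "1 \<le> 1 / a" using a by simp
    from n show False
    proof
      assume *: "r ^ n * w = a"
      show False using * n0 ra \<open>a \<noteq> w\<close> by (cases "n = 0") auto
    next
      assume *: "r ^ n * w = 1 / a"
      show False
      proof (cases "n = 0")
        case True
        hence "w = 1 / a" using * by simp
        hence "w = 1" using w a1 by simp
        hence "a = 1" using \<open>w = 1 / a\<close> a by (simp add: field_simps)
        thus False using \<open>w = 1\<close> \<open>a \<noteq> w\<close> by simp
      qed (use * n0 r a1 in auto)
    qed
  next
    assume "?p (of_real (r / w)) = 0"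
    then obtain n where n: "r ^ n * (r / w) = a \<or> r ^ n * (r / w) = 1 / a" using zeroD by blast
    have "r ^ n * (r / w) \<le> 1 * (r / w)"
      using r w by (intro mult_right_mono power_le_one) auto
    hence le2: "r ^ n * (r / w) \<le> r / w" by simp
    also have "\<dots> \<le> w" using w by (simp add: field_simps power2_eq_square)
    finally have le: "r ^ n * (r / w) \<le> w" "r ^ n * (r / w) \<le> r / w"
      using le2 by auto
    have a1: "1 \<le> 1 / a" using a by simp
    from n show False
    proof
      assume *: "r ^ n * (r / w) = a"
      have "a < w" using * le \<open>a \<noteq> w\<close> by simp
      hence "a * a < w * a" using a by simp
      also have "\<dots> \<le> r" using le(2) * w by (simp add: field_simps)
      finally show False using a by (simp add: power2_eq_square)
    next
      assume *: "r ^ n * (r / w) = 1 / a"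
      hence "w = 1" using le a1 w by simp
      hence "1 \<le> r" using * le a1 by simp
      thus False using r by simp
    qed
  qed
qed

text \<open>The reference functions with zeros at \<open>w1\<close> and \<open>w2\<close> serve as
  the dual basis of \<open>qdet_eq_zero_if_two_zeros\<close>.\<close>

lemma qdet_zero_unique:
  fixes r w1 w2 :: real
  assumes r: "0 < r" "r < 1" and w1: "0 < w1" "w1 \<le> 1" "r \<le> w1\<^sup>2" and w2: "0 < w2" "w2 \<le> 1" "r \<le> w2\<^sup>2"
    and "w1 \<noteq> w2"
    and zeros: "qdet (of_real r) \<alpha> \<gamma> (of_real w1) = 0" "qdet (of_real r) \<alpha> \<gamma> (of_real w2) = 0"
    and "w \<noteq> 0"
  shows "qdet (of_real r) \<alpha> \<gamma> w = 0"
proof (rule qdet_eq_zero_if_two_zeros[OF _ _ refl _ _ refl])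
  show "qdet (of_real r) (- (of_real w1 + 1 / of_real w1)) 0 (of_real w1) = 0"
    "qdet (of_real r) (- (of_real w2 + 1 / of_real w2)) 0 (of_real w2) = 0"
    by (rule qdet_reference_zero; use r w1 w2 in simp)+
  show "qdet (of_real r) (- (of_real w1 + 1 / of_real w1)) 0 (of_real w2) \<noteq> 0"
    "qdet (of_real r) (- (of_real w2 + 1 / of_real w2)) 0 (of_real w1) \<noteq> 0"
    by (rule qdet_reference_nonzero; use assms in simp)+
qed (use assms in auto)

section \<open>The three-term recurrence\<close>

text \<open>The eigenvalue equation for e is the case \<omega> = 2 pi / T, \<mu> = e / pi, with
  \<open>y n = mh_gamma T n k * x n\<close>; see \<open>mh_eigenspace_iff\<close>.\<close>

definition mh_solution :: "real \<Rightarrow> real \<Rightarrow> real \<Rightarrow> real \<Rightarrow> (int \<Rightarrow> complex) \<Rightarrow> bool" where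
  "mh_solution \<omega> A \<mu> k y \<longleftrightarrow>
     (\<forall>n. y (n + 1) + y (n - 1) = of_real (2 * (\<mu> * cosh (pi * (\<omega> * real_of_int n + k)) - A)) * y n)"

text \<open>Evenness of \<open>cosh\<close> trades n for -n and k for -k; this turns decay at
  +infinity into decay at -infinity.\<close>

lemma mh_solution_reflect:
  assumes "mh_solution \<omega> A \<mu> k y"
  shows "mh_solution \<omega> A \<mu> (- k) (\<lambda>n. y (- n))"
  unfolding mh_solution_def
proof
  fix n
  have "cosh (pi * (\<omega> * real_of_int (- n) + k)) = cosh (pi * (\<omega> * real_of_int n + - k))"
    by (subst cosh_minus[symmetric]) (simp add: algebra_simps)
  moreover have "y (- n + 1) + y (- n - 1) = of_real (2 * (\<mu> * cosh (pi * (\<omega> * real_of_int (- n) + k)) - A)) * y (- n)"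
    using assms unfolding mh_solution_def by blast
  ultimately have "y (- n + 1) + y (- n - 1) = of_real (2 * (\<mu> * cosh (pi * (\<omega> * real_of_int n + - k)) - A)) * y (- n)"
    by simp
  moreover have "- n + 1 = - (n - 1)" "- n - 1 = - (n + 1)" by simp_all
  ultimately show "y (- (n + 1)) + y (- (n - 1)) =
      of_real (2 * (\<mu> * cosh (pi * (\<omega> * real_of_int n + - k)) - A)) * y (- n)"
    by (simp only: add.commute)
qed

lemma mh_solution_lincomb:
  assumes "mh_solution \<omega> A \<mu> k y" "mh_solution \<omega> A \<mu> k z"
  shows "mh_solution \<omega> A \<mu> k (\<lambda>n. a * y n + b * z n)"
  unfolding mh_solution_def
proof
  fix n
  let ?v = "complex_of_real (2 * (\<mu> * cosh (pi * (\<omega> * real_of_int n + k)) - A))"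
  have "a * y (n + 1) + b * z (n + 1) + (a * y (n - 1) + b * z (n - 1))
      = a * (y (n + 1) + y (n - 1)) + b * (z (n + 1) + z (n - 1))"
    by (simp add: algebra_simps)
  also have "\<dots> = a * (?v * y n) + b * (?v * z n)"
    using assms unfolding mh_solution_def by presburger
  finally show "a * y (n + 1) + b * z (n + 1) + (a * y (n - 1) + b * z (n - 1)) = ?v * (a * y n + b * z n)"
    by (simp add: algebra_simps)
qed

lemma mh_solution_zero:
  assumes "mh_solution \<omega> A \<mu> k y" "y m = 0" "y (m + 1) = 0"
  shows "y n = 0"
proof -
  have "y n = 0 \<and> y (n + 1) = 0"
  proof (induction n rule: int_induct[of _ m])
    case base thus ?case using assms by simp
  next
    case (step1 i)
    have "y (i + 1 + 1) + y (i + 1 - 1) = of_real (2 * (\<mu> * cosh (pi * (\<omega> * real_of_int (i + 1) + k)) - A)) * y (i + 1)"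
      using assms(1) unfolding mh_solution_def by blast
    thus ?case using step1 by simp
  next
    case (step2 i)
    have "y (i + 1) + y (i - 1) = of_real (2 * (\<mu> * cosh (pi * (\<omega> * real_of_int i + k)) - A)) * y i"
      using assms(1) unfolding mh_solution_def by blast
    thus ?case using step2 by simp
  qed
  thus ?thesis by simp
qed

text \<open>Both solutions have the same coefficient v, and its contributions cancel in the
  antisymmetric expression.\<close>

lemma casoratian_const:
  assumes "mh_solution \<omega> A \<mu> k y" "mh_solution \<omega> A \<mu> k z"
  shows "y (n + 1) * z n - y n * z (n + 1) = y (m + 1) * z m - y m * z (m + 1)"
proof -
  have step: "y (i + 1) * z i - y i * z (i + 1) = y i * z (i - 1) - y (i - 1) * z i" for i
  proof -
    define v where "v = complex_of_real (2 * (\<mu> * cosh (pi * (\<omega> * real_of_int i + k)) - A))"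
    have "y (i + 1) + y (i - 1) = v * y i" "z (i + 1) + z (i - 1) = v * z i"
      using assms unfolding mh_solution_def v_def by blast+
    hence "y (i + 1) = v * y i - y (i - 1)" "z (i + 1) = v * z i - z (i - 1)"
      by (simp_all only: eq_diff_eq)
    thus ?thesis by (simp only:) (simp add: algebra_simps)
  qed
  show ?thesis
  proof (induction n rule: int_induct[of _ m])
    case (step1 i) thus ?case using step[of "i + 1"] by simp
  next
    case (step2 i) thus ?case using step[of i] by simp
  qed simp
qed

lemma mh_solution_proportional:
  assumes y: "mh_solution \<omega> A \<mu> k y" and z: "mh_solution \<omega> A \<mu> k z"
    and cas: "y (m + 1) * z m - y m * z (m + 1) = 0" and nz: "z l \<noteq> 0"
  obtains c where "\<And>n. y n = c * z n"
proof -
  have "z m \<noteq> 0 \<or> z (m + 1) \<noteq> 0" using mh_solution_zero[OF z] nz by blast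
  then obtain c where c: "y m = c * z m" "y (m + 1) = c * z (m + 1)"
  proof
    assume "z m \<noteq> 0"
    thus ?thesis using cas by (intro that[of "y m / z m"]) (auto simp: field_simps)
  next
    assume "z (m + 1) \<noteq> 0"
    thus ?thesis using cas by (intro that[of "y (m + 1) / z (m + 1)"]) (auto simp: field_simps)
  qed
  have "1 * y n + (- c) * z n = 0" for n
    by (rule mh_solution_zero[OF mh_solution_lincomb[OF y z, of 1 "- c"], of m]) (simp_all add: c)
  thus ?thesis using that[of c] by simp
qed

section \<open>Solutions decaying at +infinity\<close>

text \<open>For large n the recurrence is dominated by y (n - 1) ~ \<mu> exp (pi (\<omega> n + k)) y
  n. This Gaussian solves that first-order relation exactly, as \<open>jost_weight_Suc\<close>
  shows.\<close>

definition jost_weight :: "real \<Rightarrow> real \<Rightarrow> real \<Rightarrow> int \<Rightarrow> real" where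
  "jost_weight \<omega> \<mu> k n = \<mu> powi (- n) * exp (- (pi * (\<omega> * (real_of_int n * (real_of_int n + 1) / 2) + k * real_of_int n)))"

text \<open>The parameters are those for which \<open>qpsi_rec\<close> at w = exp (-pi (\<omega> n +
  k)) becomes the three-term recurrence after division by the weight.\<close>

definition mh_psi :: "real \<Rightarrow> real \<Rightarrow> real \<Rightarrow> complex \<Rightarrow> complex" where
  "mh_psi \<omega> A \<mu> = qpsi (of_real (exp (- (pi * \<omega>)))) (of_real (- 2 * A / \<mu>)) (of_real (- exp (- (pi * \<omega>)) / \<mu>\<^sup>2))"

definition mh_det :: "real \<Rightarrow> real \<Rightarrow> real \<Rightarrow> complex \<Rightarrow> complex" where
  "mh_det \<omega> A \<mu> = qdet (of_real (exp (- (pi * \<omega>)))) (of_real (- 2 * A / \<mu>)) (of_real (- exp (- (pi * \<omega>)) / \<mu>\<^sup>2))"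

text \<open>Evaluating at n + 1 makes the sites n - 1, n, n + 1 correspond to the arguments w, q w,
  q^2 w of \<open>qpsi_rec\<close>, where w = exp (-pi (\<omega> n + k)).\<close>

definition jost :: "real \<Rightarrow> real \<Rightarrow> real \<Rightarrow> real \<Rightarrow> int \<Rightarrow> complex" where
  "jost \<omega> A \<mu> k n = of_real (jost_weight \<omega> \<mu> k n) *
     mh_psi \<omega> A \<mu> (of_real (exp (- (pi * (\<omega> * (real_of_int n + 1) + k)))))"

lemma jost_weight_Suc:
  assumes "\<mu> \<noteq> 0"
  shows "jost_weight \<omega> \<mu> k (n + 1) =
    exp (- (pi * (\<omega> * (real_of_int n + 1) + k))) / \<mu> * jost_weight \<omega> \<mu> k n"
proof -
  have "\<mu> powi (- (n + 1)) = \<mu> powi (- n) / \<mu>"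
    using assms power_int_diff[of \<mu> "- n" 1] by (simp only: minus_add_distrib) simp
  moreover have "exp (- (pi * (\<omega> * (real_of_int (n + 1) * (real_of_int (n + 1) + 1) / 2) + k * real_of_int (n + 1))))
    = exp (- (pi * (\<omega> * (real_of_int n + 1) + k))) *
      exp (- (pi * (\<omega> * (real_of_int n * (real_of_int n + 1) / 2) + k * real_of_int n)))"
    unfolding exp_add[symmetric] by (rule arg_cong[of _ _ exp]) (simp add: field_simps)
  ultimately show ?thesis unfolding jost_weight_def by simp
qed

lemma mh_solution_jost:
  assumes "\<omega> > 0" "\<mu> \<noteq> 0"
  shows "mh_solution \<omega> A \<mu> k (jost \<omega> A \<mu> k)"
  unfolding mh_solution_def
proof
  fix n
  define w where "w = exp (- (pi * (\<omega> * real_of_int n + k)))"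
  define r where "r = exp (- (pi * \<omega>))"
  define \<alpha> where "\<alpha> = - 2 * A / \<mu>"
  define \<gamma> where "\<gamma> = - r / \<mu>\<^sup>2"
  define p1 where "p1 = mh_psi \<omega> A \<mu> (of_real (r * w))"
  define p2 where "p2 = mh_psi \<omega> A \<mu> (of_real (r\<^sup>2 * w))"
  have w0: "w > 0" by (simp add: w_def)
  have r: "norm (complex_of_real r) < 1" using assms by (simp add: r_def)
  have p0: "mh_psi \<omega> A \<mu> (of_real w) = of_real (1 + \<alpha> * w + w\<^sup>2) * p1 + of_real (\<gamma> * w\<^sup>2) * p2"
    unfolding p1_def p2_def mh_psi_def
    using qpsi_rec[OF r, of "of_real \<alpha>" "of_real \<gamma>" "of_real w"]
    by (simp add: r_def[symmetric] \<alpha>_def \<gamma>_def)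
  have rw: "exp (- (pi * (\<omega> * (real_of_int n + 1) + k))) = r * w"
    and rrw: "exp (- (pi * (\<omega> * (real_of_int (n + 1) + 1) + k))) = r\<^sup>2 * w"
    and ww: "exp (- (pi * (\<omega> * (real_of_int (n - 1) + 1) + k))) = w"
    unfolding r_def w_def power2_eq_square exp_add[symmetric]
    by (rule arg_cong[of _ _ exp], simp add: field_simps)+
  have g1: "jost_weight \<omega> \<mu> k (n + 1) = r * w / \<mu> * jost_weight \<omega> \<mu> k n"
    unfolding jost_weight_Suc[OF assms(2)] rw ..
  have "jost_weight \<omega> \<mu> k n = w / \<mu> * jost_weight \<omega> \<mu> k (n - 1)"
    using jost_weight_Suc[OF assms(2), of \<omega> k "n - 1"] by (simp add: w_def)
  hence g0: "jost_weight \<omega> \<mu> k (n - 1) = \<mu> / w * jost_weight \<omega> \<mu> k n"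
    using assms w0 by (simp add: field_simps)
  have c: "2 * cosh (pi * (\<omega> * real_of_int n + k)) = w + 1 / w"
    by (simp add: cosh_def w_def exp_minus inverse_eq_divide)
  \<comment> \<open>The choice of \<alpha> makes the coefficient of \<open>p1\<close> the required
    one, and the choice of \<gamma> cancels the two terms with \<open>p2\<close>.\<close>
  have 1: "\<mu> / w * (1 + \<alpha> * w + w\<^sup>2) = 2 * (\<mu> * cosh (pi * (\<omega> * real_of_int n + k)) - A)"
  proof -
    have "\<mu> / w * (1 + \<alpha> * w + w\<^sup>2) = \<mu> * (w + 1 / w) - 2 * A"
      using assms w0 by (simp add: \<alpha>_def field_simps power2_eq_square)
    thus ?thesis unfolding c[symmetric] by simp
  qed
  have 2: "\<mu> / w * (\<gamma> * w\<^sup>2) + r * w / \<mu> = 0"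
    using assms w0 by (simp add: \<gamma>_def field_simps power2_eq_square)
  let ?g = "complex_of_real (jost_weight \<omega> \<mu> k n)"
  have "jost \<omega> A \<mu> k (n + 1) + jost \<omega> A \<mu> k (n - 1)
    = ?g * (of_real (r * w / \<mu>) * p2 + of_real (\<mu> / w) * (of_real (1 + \<alpha> * w + w\<^sup>2) * p1 + of_real (\<gamma> * w\<^sup>2) * p2))"
    unfolding jost_def rrw ww p2_def[symmetric] p0 g0 g1 by (simp add: algebra_simps)
  also have "\<dots> = ?g * (of_real (\<mu> / w * (1 + \<alpha> * w + w\<^sup>2)) * p1 + of_real (\<mu> / w * (\<gamma> * w\<^sup>2) + r * w / \<mu>) * p2)"
    by (simp add: algebra_simps)
  also have "\<dots> = of_real (2 * (\<mu> * cosh (pi * (\<omega> * real_of_int n + k)) - A)) * jost \<omega> A \<mu> k n"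
    unfolding 1 2 jost_def rw p1_def by simp
  finally show "jost \<omega> A \<mu> k (n + 1) + jost \<omega> A \<mu> k (n - 1) =
      of_real (2 * (\<mu> * cosh (pi * (\<omega> * real_of_int n + k)) - A)) * jost \<omega> A \<mu> k n" .
qed

lemma mh_psi_tendsto_1:
  assumes "\<omega> > 0"
  shows "(\<lambda>n. mh_psi \<omega> A \<mu> (of_real (exp (- (pi * (\<omega> * (real_of_int (int n) + 1) + k)))))) \<longlonglongrightarrow> 1"
proof -
  have r: "norm (complex_of_real (exp (- (pi * \<omega>)))) < 1" using assms by simp
  have "exp (- (pi * (\<omega> * (real_of_int (int n) + 1) + k))) = exp (- (pi * \<omega>)) ^ n * exp (- (pi * (\<omega> + k)))" for n
    unfolding exp_of_nat_mult[symmetric] exp_add[symmetric]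
    by (rule arg_cong[of _ _ exp]) (simp add: algebra_simps)
  thus ?thesis
    using qpsi_power_tendsto_1[OF r] unfolding mh_psi_def by (simp only: of_real_mult of_real_power)
qed

lemma cosh_add_le:
  fixes x y :: real
  assumes "y \<ge> 0"
  shows "cosh (x + y) \<le> exp y * cosh x"
proof -
  have "exp (- (x + y)) \<le> exp (y - x)" using assms by simp
  thus ?thesis by (simp add: cosh_def exp_add[symmetric] distrib_left add.commute)
qed

text \<open>The factor \<open>cosh\<close> comes from dividing by \<open>mh_gamma\<close>: up to
  1/pi these are the squared moduli of the candidate eigenvector. The squared Gaussian beats the
  exponential growth of \<open>cosh\<close>.\<close>

lemma jost_summable:
  assumes "\<omega> > 0" "\<mu> \<noteq> 0"
  shows "summable (\<lambda>n. (norm (jost \<omega> A \<mu> k (int n)))\<^sup>2 * cosh (pi * (\<omega> * real_of_int (int n) + k)))"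
proof -
  define b where "b = (\<lambda>n. (jost_weight \<omega> \<mu> k (int n))\<^sup>2 * cosh (pi * (\<omega> * real_of_int (int n) + k)))"
  \<comment> \<open>A bound for the ratio of consecutive terms of \<open>b\<close>: the squared
    weight ratio times the growth of \<open>cosh\<close> over one step.\<close>
  define e where "e = (\<lambda>n. (exp (- (pi * (\<omega> * (real n + 1) + k))) / \<mu>)\<^sup>2 * exp (pi * \<omega>))"
  have b0: "b n \<ge> 0" for n by (simp add: b_def cosh_real_nonneg)
  have "(\<lambda>n. exp (- (pi * (\<omega> + k))) * exp (- (pi * \<omega>)) ^ n) \<longlonglongrightarrow> exp (- (pi * (\<omega> + k))) * 0"
    using assms by (intro tendsto_mult tendsto_const LIMSEQ_power_zero) simp
  moreover have "exp (- (pi * (\<omega> + k))) * exp (- (pi * \<omega>)) ^ n = exp (- (pi * (\<omega> * (real n + 1) + k)))" for n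
    unfolding exp_of_nat_mult[symmetric] exp_add[symmetric]
    by (rule arg_cong[of _ _ exp]) (simp add: algebra_simps)
  ultimately have "(\<lambda>n. exp (- (pi * (\<omega> * (real n + 1) + k)))) \<longlonglongrightarrow> 0" by simp
  hence "e \<longlonglongrightarrow> (0 / \<mu>)\<^sup>2 * exp (pi * \<omega>)"
    unfolding e_def using assms by (intro tendsto_intros) auto
  hence "eventually (\<lambda>n. e n < 1 / 2) sequentially"
    by (intro order_tendstoD) auto
  then obtain N where N: "\<And>n. n \<ge> N \<Longrightarrow> e n < 1 / 2" by (auto simp: eventually_sequentially)
  have "summable b"
  proof (rule summable_ratio_test[of "1/2" N])
    fix n assume "n \<ge> N"
    have "b (Suc n) = (jost_weight \<omega> \<mu> k (int n + 1))\<^sup>2 * cosh (pi * (\<omega> * real n + k) + pi * \<omega>)"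
      unfolding b_def by (simp add: algebra_simps)
    also have "\<dots> \<le> (jost_weight \<omega> \<mu> k (int n + 1))\<^sup>2 * (exp (pi * \<omega>) * cosh (pi * (\<omega> * real n + k)))"
      by (intro mult_left_mono cosh_add_le) (use assms in auto)
    also have "\<dots> = e n * b n"
      unfolding jost_weight_Suc[OF assms(2)] b_def e_def power_mult_distrib by simp
    also have "\<dots> \<le> 1 / 2 * b n"
      using N[OF \<open>n \<ge> N\<close>] b0[of n] by (intro mult_right_mono) auto
    finally show "norm (b (Suc n)) \<le> 1 / 2 * norm (b n)" using b0 by simp
  qed simp
  define p where "p = (\<lambda>n. mh_psi \<omega> A \<mu> (of_real (exp (- (pi * (\<omega> * (real_of_int (int n) + 1) + k))))))"
  have "p \<longlonglongrightarrow> 1" unfolding p_def by (rule mh_psi_tendsto_1[OF assms(1)])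
  hence "(\<lambda>n. norm (p n)) \<longlonglongrightarrow> 1" using tendsto_norm by fastforce
  hence "eventually (\<lambda>n. norm (p n) < 2) sequentially" by (rule order_tendstoD) simp
  then obtain M where M: "\<And>n. n \<ge> M \<Longrightarrow> norm (p n) < 2" by (auto simp: eventually_sequentially)
  show ?thesis
  proof (rule summable_comparison_test'[of "\<lambda>n. 4 * b n" M])
    show "summable (\<lambda>n. 4 * b n)" using \<open>summable b\<close> by (rule summable_mult)
    fix n assume "n \<ge> M"
    have eq: "(norm (jost \<omega> A \<mu> k (int n)))\<^sup>2 * cosh (pi * (\<omega> * real_of_int (int n) + k)) = (norm (p n))\<^sup>2 * b n"
      unfolding jost_def p_def b_def norm_mult power_mult_distrib by (simp add: mult_ac)
    have "(norm (p n))\<^sup>2 \<le> 2\<^sup>2" using M[OF \<open>n \<ge> M\<close>] by (intro power_mono) auto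
    hence "(norm (p n))\<^sup>2 * b n \<le> 4 * b n" using b0 by (intro mult_right_mono) auto
    thus "norm ((norm (jost \<omega> A \<mu> k (int n)))\<^sup>2 * cosh (pi * (\<omega> * real_of_int (int n) + k))) \<le> 4 * b n"
      unfolding eq using b0 by (simp add: abs_mult)
  qed
qed

lemma jost_tendsto_0:
  assumes "\<omega> > 0" "\<mu> \<noteq> 0"
  shows "(\<lambda>n. jost \<omega> A \<mu> k (int n)) \<longlonglongrightarrow> 0"
proof -
  have "summable (\<lambda>n. (norm (jost \<omega> A \<mu> k (int n)))\<^sup>2)"
  proof (rule summable_comparison_test'[OF jost_summable[OF assms, of A k], of 0])
    fix n
    have "(norm (jost \<omega> A \<mu> k (int n)))\<^sup>2 * 1 \<le> (norm (jost \<omega> A \<mu> k (int n)))\<^sup>2 * cosh (pi * (\<omega> * real_of_int (int n) + k))"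
      by (intro mult_left_mono cosh_real_ge_1) auto
    thus "norm ((norm (jost \<omega> A \<mu> k (int n)))\<^sup>2) \<le> (norm (jost \<omega> A \<mu> k (int n)))\<^sup>2 * cosh (pi * (\<omega> * real_of_int (int n) + k))"
      by simp
  qed
  hence "(\<lambda>n. (norm (jost \<omega> A \<mu> k (int n)))\<^sup>2) \<longlonglongrightarrow> 0" by (rule summable_LIMSEQ_zero)
  hence "(\<lambda>n. sqrt ((norm (jost \<omega> A \<mu> k (int n)))\<^sup>2)) \<longlonglongrightarrow> sqrt 0" by (rule tendsto_real_sqrt)
  thus ?thesis by (simp add: tendsto_norm_zero_iff)
qed

lemma jost_nonzero:
  assumes "\<omega> > 0" "\<mu> \<noteq> 0"
  obtains n where "jost \<omega> A \<mu> k n \<noteq> 0"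
proof -
  have "eventually (\<lambda>n. mh_psi \<omega> A \<mu> (of_real (exp (- (pi * (\<omega> * (real_of_int (int n) + 1) + k))))) \<noteq> 0) sequentially"
    by (rule tendsto_imp_eventually_ne[OF mh_psi_tendsto_1[OF assms(1)]]) simp
  then obtain n where "mh_psi \<omega> A \<mu> (of_real (exp (- (pi * (\<omega> * (real_of_int (int n) + 1) + k))))) \<noteq> 0"
    by (auto simp: eventually_sequentially)
  thus ?thesis using assms by (intro that[of "int n"]) (auto simp: jost_def jost_weight_def)
qed

text \<open>The Casoratian of \<open>jost\<close> at k and the reflected \<open>jost\<close> at -k,
  taken at the sites -1 and 0, where the arguments of \<open>mh_psi\<close> are the four that occur
  in \<open>qdet\<close>.\<close>

lemma jost_casoratian:
  assumes "\<mu> \<noteq> 0"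
  shows "jost \<omega> A \<mu> k 0 * jost \<omega> A \<mu> (- k) 1 - jost \<omega> A \<mu> k (- 1) * jost \<omega> A \<mu> (- k) 0
    = - of_real (\<mu> * exp (pi * k)) * mh_det \<omega> A \<mu> (of_real (exp (- (pi * k))))"
proof -
  define r where "r = exp (- (pi * \<omega>))"
  define w where "w = exp (- (pi * k))"
  have w0: "w > 0" by (simp add: w_def)
  have e: "exp (- (pi * (\<omega> * (real_of_int 0 + 1) + k))) = r * w"
    "exp (- (pi * (\<omega> * (real_of_int (- 1) + 1) + k))) = w"
    "exp (- (pi * (\<omega> * (real_of_int 0 + 1) + - k))) = r / w"
    "exp (- (pi * (\<omega> * (real_of_int 1 + 1) + - k))) = r\<^sup>2 / w"
    "exp (pi * k) = 1 / w"
    by (simp_all add: r_def w_def power2_eq_square exp_add[symmetric] exp_diff[symmetric]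
        exp_minus_inverse algebra_simps flip: exp_minus inverse_eq_divide)
  have g: "jost_weight \<omega> \<mu> k 0 = 1" "jost_weight \<omega> \<mu> (- k) 0 = 1"
    "jost_weight \<omega> \<mu> k (- 1) = \<mu> / w" "jost_weight \<omega> \<mu> (- k) 1 = r / (\<mu> * w)"
    using assms
    by (simp_all add: jost_weight_def r_def w_def exp_minus power_int_minus field_simps exp_add exp_diff)
  show ?thesis
    unfolding jost_def e g mh_det_def qdet_def mh_psi_def[symmetric] r_def[symmetric] w_def[symmetric]
    using assms w0
    by (simp add: mh_psi_def r_def[symmetric] field_simps power2_eq_square)
qed

section \<open>Eigenvalues of the fiber operators\<close>

text \<open>With w = exp (-pi k), reflection of k is inversion of w and translation by \<omega> is
  multiplication by q; the factor w^2 in the \<open>qdet\<close> identities is nonzero.\<close>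

lemma mh_det_reflect_shift:
  assumes "\<omega> > 0"
  shows "mh_det \<omega> A \<mu> (of_real (exp (- (pi * - k)))) = 0 \<longleftrightarrow> mh_det \<omega> A \<mu> (of_real (exp (- (pi * k)))) = 0"
    and "mh_det \<omega> A \<mu> (of_real (exp (- (pi * (k + \<omega>))))) = 0 \<longleftrightarrow> mh_det \<omega> A \<mu> (of_real (exp (- (pi * k)))) = 0"
proof -
  let ?q = "complex_of_real (exp (- (pi * \<omega>)))" and ?w = "complex_of_real (exp (- (pi * k)))"
  have q: "norm ?q < 1" "?w \<noteq> 0" "?q \<noteq> 0" using assms by auto
  have "complex_of_real (exp (- (pi * - k))) = 1 / ?w"
    by (simp add: exp_minus inverse_eq_divide)
  thus "mh_det \<omega> A \<mu> (of_real (exp (- (pi * - k)))) = 0 \<longleftrightarrow> mh_det \<omega> A \<mu> ?w = 0"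
    unfolding mh_det_def using qdet_inverse[OF q] q(2) by (metis mult_eq_0_iff power_eq_0_iff)
  have "exp (- (pi * (k + \<omega>))) = exp (- (pi * \<omega>)) * exp (- (pi * k))"
    unfolding exp_add[symmetric] by (simp add: algebra_simps)
  hence "complex_of_real (exp (- (pi * (k + \<omega>)))) = ?q * ?w" by simp
  thus "mh_det \<omega> A \<mu> (of_real (exp (- (pi * (k + \<omega>))))) = 0 \<longleftrightarrow> mh_det \<omega> A \<mu> ?w = 0"
    unfolding mh_det_def using qdet_shift[OF q] q(2) by (metis mult_eq_0_iff power_eq_0_iff)
qed

section \<open>From eigenvectors to decaying solutions\<close>

text \<open>The conjugate of z = 1/2 + i t is 1 - z, so Euler's reflection formula gives pi / sin
  (pi z) = pi / cosh (pi t).\<close>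

lemma mh_gamma_cnj:
  "cnj (mh_gamma T n k) * mh_gamma T n k = of_real (pi / cosh (pi * (2 * pi / T * real_of_int n + k)))"
proof -
  define t where "t = 2 * pi / T * real_of_int n + k"
  have "cnj (mh_gamma T n k) = Gamma (1 - (1/2 + \<i> * complex_of_real t))"
    unfolding mh_gamma_def cnj_Gamma t_def by (rule arg_cong[of _ _ Gamma]) (simp add: complex_eq_iff)
  moreover have "sin (of_real pi * (1/2 + \<i> * complex_of_real t)) = of_real (cosh (pi * t))"
  proof -
    have "sin (of_real pi * (1/2 + \<i> * complex_of_real t)) = sin (of_real pi / 2 - - (\<i> * of_real (pi * t)))"
      by (rule arg_cong[of _ _ sin]) (simp add: algebra_simps)
    also have "\<dots> = cos (- (\<i> * of_real (pi * t)))"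
      by (rule cos_sin_eq[symmetric])
    also have "\<dots> = cosh (of_real (pi * t))"
      by (simp only: cos_minus cosh_conv_cos)
    also have "\<dots> = of_real (cosh (pi * t))"
      by (simp add: cosh_field_def flip: exp_of_real)
    finally show ?thesis .
  qed
  ultimately show ?thesis
    using Gamma_reflection_complex[of "1/2 + \<i> * complex_of_real t"]
    by (simp add: mh_gamma_def t_def mult.commute)
qed

lemma mh_gamma_nonzero: "mh_gamma T n k \<noteq> 0"
proof
  assume "mh_gamma T n k = 0"
  with mh_gamma_cnj[of T n k] have "complex_of_real (pi / cosh (pi * (2 * pi / T * real_of_int n + k))) = 0"
    by simp
  thus False unfolding of_real_eq_0_iff by simp
qed

lemma norm_mh_gamma_sq: "(norm (mh_gamma T n k))\<^sup>2 = pi / cosh (pi * (2 * pi / T * real_of_int n + k))"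
proof -
  have "complex_of_real ((norm (mh_gamma T n k))\<^sup>2) = cnj (mh_gamma T n k) * mh_gamma T n k"
    by (metis complex_norm_square mult.commute of_real_power)
  thus ?thesis unfolding mh_gamma_cnj of_real_eq_iff .
qed

lemma mh_apply_eq:
  "mh_apply T A k x n = cnj (mh_gamma T n k) *
     (1/2 * (mh_gamma T (n - 1) k * x (n - 1)) + of_real A * (mh_gamma T n k * x n)
       + 1/2 * (mh_gamma T (n + 1) k * x (n + 1)))"
proof -
  have "mh_apply T A k x n = (\<Sum>\<^sub>\<infinity>m\<in>{n - 1, n, n + 1}. mh_entry T A k n m * x m)"
    unfolding mh_apply_def by (rule infsum_cong_neutral) (auto simp: mh_entry_def mh_s_def)
  also have "\<dots> = (\<Sum>m\<in>{n - 1, n, n + 1}. mh_entry T A k n m * x m)"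
    by (rule infsum_finite) simp
  also have "\<dots> = mh_entry T A k n (n - 1) * x (n - 1) + mh_entry T A k n n * x n
      + mh_entry T A k n (n + 1) * x (n + 1)"
    by simp
  finally show ?thesis by (simp add: mh_entry_def mh_s_def algebra_simps)
qed

lemma mh_eigenspace_iff:
  "x \<in> mh_eigenspace T A k (of_real e) \<longleftrightarrow>
     l2seq x \<and> mh_solution (2 * pi / T) A (e / pi) k (\<lambda>n. mh_gamma T n k * x n)"
proof -
  have "mh_apply T A k x n = of_real e * x n \<longleftrightarrow>
    mh_gamma T (n + 1) k * x (n + 1) + mh_gamma T (n - 1) k * x (n - 1) =
    of_real (2 * (e / pi * cosh (pi * (2 * pi / T * real_of_int n + k)) - A)) * (mh_gamma T n k * x n)"
    (is "?L \<longleftrightarrow> ?p + ?m = of_real (2 * (e / pi * ?c - A)) * ?y") for n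
  proof -
    let ?g = "mh_gamma T n k"
    have c: "?c \<noteq> 0" by simp
    have cc: "cnj ?g * ?g = of_real (pi / ?c)" by (rule mh_gamma_cnj)
    have "?L \<longleftrightarrow> cnj ?g * (1/2 * ?m + of_real A * ?y + 1/2 * ?p) * ?g = of_real e * x n * ?g"
      unfolding mh_apply_eq using mh_gamma_nonzero[of T n k] by simp
    also have "cnj ?g * (1/2 * ?m + of_real A * ?y + 1/2 * ?p) * ?g
        = (cnj ?g * ?g) * (1/2 * ?m + of_real A * ?y + 1/2 * ?p)"
      by (simp only: mult_ac)
    also have "of_real e * x n * ?g = of_real e * ?y" by (simp only: mult_ac)
    \<comment> \<open>The factor \<open>2 * ?c / pi\<close> normalises the coefficients of both
      neighbours to 1.\<close>
    also have "cnj ?g * ?g * (1/2 * ?m + of_real A * ?y + 1/2 * ?p) = of_real e * ?y \<longleftrightarrow>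
        of_real (2 * ?c / pi) * (of_real (pi / ?c) * (1/2 * ?m + of_real A * ?y + 1/2 * ?p)) = of_real (2 * ?c / pi) * (of_real e * ?y)"
      unfolding cc using c by (simp only: mult_cancel_left of_real_eq_0_iff) simp
    also have "of_real (2 * ?c / pi) * (of_real (pi / ?c) * (1/2 * ?m + of_real A * ?y + 1/2 * ?p))
        = ?p + ?m + of_real (2 * A) * ?y"
    proof -
      have "of_real (2 * ?c / pi) * (of_real (pi / ?c) * z) = 2 * z" for z :: complex
        unfolding mult.assoc[symmetric] of_real_mult[symmetric] using c by simp
      thus ?thesis by (simp add: algebra_simps)
    qed
    also have "?p + ?m + of_real (2 * A) * ?y = of_real (2 * ?c / pi) * (of_real e * ?y) \<longleftrightarrow>
        ?p + ?m = of_real (2 * (e / pi * ?c - A)) * ?y"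
    proof -
      have "of_real (2 * ?c / pi) * (of_real e * ?y) = of_real (2 * (e / pi * ?c - A)) * ?y + of_real (2 * A) * ?y"
        unfolding distrib_right[symmetric] of_real_add[symmetric] mult.assoc[symmetric] of_real_mult[symmetric]
        by (simp add: field_simps)
      thus ?thesis by simp
    qed
    finally show ?thesis .
  qed
  thus ?thesis by (simp add: mh_eigenspace_def mh_solution_def fun_eq_iff)
qed

lemma l2seq_reflect: "l2seq x \<Longrightarrow> l2seq (\<lambda>n. x (- n))"
  unfolding l2seq_def by (subst summable_on_reindex_bij_witness[of _ uminus uminus UNIV]) auto

lemma l2seq_tendsto_0:
  assumes "l2seq x"
  shows "(\<lambda>n. x (int n)) \<longlonglongrightarrow> 0"
proof -
  have "(\<lambda>n. (norm (x n))\<^sup>2) summable_on range int"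
    by (rule summable_on_subset_banach[OF assms[unfolded l2seq_def]]) auto
  hence "(\<lambda>n. (norm (x (int n)))\<^sup>2) summable_on UNIV"
    by (subst (asm) summable_on_reindex) (auto simp: o_def)
  hence "(\<lambda>n. (norm (x (int n)))\<^sup>2) \<longlonglongrightarrow> 0"
    by (intro summable_LIMSEQ_zero summable_on_imp_summable)
  hence "(\<lambda>n. sqrt ((norm (x (int n)))\<^sup>2)) \<longlonglongrightarrow> sqrt 0" by (rule tendsto_real_sqrt)
  thus ?thesis by (simp add: tendsto_norm_zero_iff)
qed

text \<open>The Casoratian with \<open>jost\<close> is constant and tends to 0, hence
  vanishes.\<close>

lemma mh_solution_decaying_proportional_jost:
  assumes "\<omega> > 0" "\<mu> \<noteq> 0" and y: "mh_solution \<omega> A \<mu> k y" and y0: "(\<lambda>n. y (int n)) \<longlonglongrightarrow> 0"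
  obtains c where "\<And>n. y n = c * jost \<omega> A \<mu> k n"
proof -
  let ?j = "jost \<omega> A \<mu> k"
  note j = mh_solution_jost[OF assms(1,2), of A k] and j0 = jost_tendsto_0[OF assms(1,2), of A k]
  have S: "(\<lambda>n. f (int n + 1)) \<longlonglongrightarrow> 0" if "(\<lambda>n. f (int n)) \<longlonglongrightarrow> (0::complex)" for f
    using LIMSEQ_Suc[OF that] by (simp add: add.commute)
  have "(\<lambda>n. y (int n + 1) * ?j (int n) - y (int n) * ?j (int n + 1)) \<longlonglongrightarrow> 0 * 0 - 0 * 0"
    by (intro tendsto_diff tendsto_mult S y0 j0)
  moreover have "(\<lambda>n. y (int n + 1) * ?j (int n) - y (int n) * ?j (int n + 1))
      = (\<lambda>n. y (0 + 1) * ?j 0 - y 0 * ?j (0 + 1))"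
    by (rule ext) (rule casoratian_const[OF y j])
  ultimately have "(\<lambda>n::nat. y (0 + 1) * ?j 0 - y 0 * ?j (0 + 1)) \<longlonglongrightarrow> 0"
    by (simp only: mult_zero_left diff_zero)
  hence cas: "y (0 + 1) * ?j 0 - y 0 * ?j (0 + 1) = 0"
    using LIMSEQ_unique[OF tendsto_const] by blast
  obtain l where "?j l \<noteq> 0" by (rule jost_nonzero[OF assms(1,2)])
  from mh_solution_proportional[OF y j cas this] that show ?thesis by blast
qed

text \<open>Because \<open>mh_gamma\<close> is bounded, square summability of x gives decay of the
  transformed sequence at both ends; the second representation comes from reflecting the first
  argument.\<close>

lemma mh_eigenvector_proportional_jost:
  assumes "T > 0" "e \<noteq> 0" and x: "x \<in> mh_eigenspace T A k (of_real e)"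
  obtains c c' where "\<And>n. mh_gamma T n k * x n = c * jost (2 * pi / T) A (e / pi) k n"
    and "\<And>n. mh_gamma T n k * x n = c' * jost (2 * pi / T) A (e / pi) (- k) (- n)"
proof -
  let ?y = "\<lambda>n. mh_gamma T n k * x n"
  have p: "2 * pi / T > 0" "e / pi \<noteq> 0" using assms by auto
  have l2: "l2seq x" and sol: "mh_solution (2 * pi / T) A (e / pi) k ?y"
    using x unfolding mh_eigenspace_iff by auto
  have bound: "norm (mh_gamma T n k) \<le> sqrt pi" for n
  proof (rule real_le_rsqrt)
    have "pi / cosh (pi * (2 * pi / T * real_of_int n + k)) \<le> pi / 1"
      by (intro divide_left_mono cosh_real_ge_1) auto
    thus "(norm (mh_gamma T n k))\<^sup>2 \<le> pi" unfolding norm_mh_gamma_sq by simp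
  qed
  have decay: "(\<lambda>n. mh_gamma T (f n) k * z n) \<longlonglongrightarrow> 0" if "z \<longlonglongrightarrow> 0" for z and f :: "nat \<Rightarrow> int"
  proof (rule Lim_null_comparison)
    show "eventually (\<lambda>n. norm (mh_gamma T (f n) k * z n) \<le> sqrt pi * norm (z n)) sequentially"
      using bound by (intro always_eventually) (simp add: norm_mult mult_right_mono)
    show "(\<lambda>n. sqrt pi * norm (z n)) \<longlonglongrightarrow> 0"
      using that by (intro tendsto_mult_right_zero tendsto_norm_zero)
  qed
  obtain c where c: "\<And>n. ?y n = c * jost (2 * pi / T) A (e / pi) k n"
    by (rule mh_solution_decaying_proportional_jost[OF p sol decay[OF l2seq_tendsto_0[OF l2]]]) blast
  obtain c' where c': "\<And>n. ?y (- n) = c' * jost (2 * pi / T) A (e / pi) (- k) n"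
    by (rule mh_solution_decaying_proportional_jost[OF p mh_solution_reflect[OF sol]
          decay[OF l2seq_tendsto_0[OF l2seq_reflect[OF l2]]]]) blast
  show ?thesis using that[of c c'] c c'[of "- n" for n] by simp
qed

text \<open>An eigenvector is a multiple of both one-sided decaying solutions, so it forces them to
  be proportional. Conversely, if they are proportional, their common multiple decays fast enough at
  both ends.\<close>

lemma mh_eigenvector_exists_iff:
  assumes "T > 0" "e \<noteq> 0"
  shows "(\<exists>x\<in>mh_eigenspace T A k (of_real e). x \<noteq> (\<lambda>_. 0)) \<longleftrightarrow>
    mh_det (2 * pi / T) A (e / pi) (of_real (exp (- (pi * k)))) = 0" (is "?L \<longleftrightarrow> ?R")
proof -
  define \<omega> where "\<omega> = 2 * pi / T"
  define \<mu> where "\<mu> = e / pi"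
  define u where "u = jost \<omega> A \<mu> k"
  define v where "v = jost \<omega> A \<mu> (- k)"
  have p: "\<omega> > 0" "\<mu> \<noteq> 0" using assms by (auto simp: \<omega>_def \<mu>_def)
  have cas: "u 0 * v 1 - u (- 1) * v 0 = 0 \<longleftrightarrow> ?R"
    unfolding u_def v_def jost_casoratian[OF p(2)] using p by (simp add: \<omega>_def \<mu>_def)
  show ?thesis
  proof
    assume ?L
    then obtain x m where x: "x \<in> mh_eigenspace T A k (of_real e)" and m: "x m \<noteq> 0" by (auto simp: fun_eq_iff)
    from mh_eigenvector_proportional_jost[OF assms x] obtain c c'
      where c: "\<And>n. mh_gamma T n k * x n = c * u n" and c': "\<And>n. mh_gamma T n k * x n = c' * v (- n)"
      unfolding u_def v_def \<omega>_def \<mu>_def by metis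
    have "mh_gamma T m k * x m \<noteq> 0" using m mh_gamma_nonzero by simp
    hence "c \<noteq> 0" using c[of m] by auto
    hence u: "u n = c' / c * v (- n)" for n
      using c[of n] c'[of n] by (simp add: field_simps)
    have "u 0 * v 1 - u (- 1) * v 0 = 0" unfolding u by simp
    thus ?R using cas by blast
  next
    assume ?R
    hence "u 0 * v 1 - u (- 1) * v 0 = 0" using cas by blast
    moreover have u: "mh_solution \<omega> A \<mu> k u" unfolding u_def by (rule mh_solution_jost[OF p])
    have v: "mh_solution \<omega> A \<mu> k (\<lambda>n. v (- n))"
      using mh_solution_reflect[OF mh_solution_jost[OF p, of A "- k"]] by (simp add: v_def)
    obtain l where "v l \<noteq> 0" unfolding v_def by (rule jost_nonzero[OF p])
    hence l: "v (- (- l)) \<noteq> 0" by simp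
    obtain c where c: "\<And>n. u n = c * v (- n)"
      \<comment> \<open>At the site -1 the Casoratian of u and the reflected v is exactly
        \<open>u 0 * v 1 - u (- 1) * v 0\<close>.\<close>
      by (rule mh_solution_proportional[OF u v, of "- 1" "- l"]) (use calculation l in auto)
    define x where "x = (\<lambda>n. u n / mh_gamma T n k)"
    have x2: "(norm (x n))\<^sup>2 = 1 / pi * ((norm (u n))\<^sup>2 * cosh (pi * (\<omega> * real_of_int n + k)))" for n
      unfolding x_def norm_divide power_divide norm_mh_gamma_sq \<omega>_def by simp
    \<comment> \<open>On the right half-line u is used directly; on the left one it is replaced by c
      times the reflected v.\<close>
    have "(\<lambda>n. (norm (x n))\<^sup>2) summable_on (range int \<union> range (\<lambda>n. - int n))"
    proof (rule summable_on_union)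
      have "summable (\<lambda>n. (norm (x (int n)))\<^sup>2)"
        unfolding x2 u_def by (intro summable_mult jost_summable p)
      thus "(\<lambda>n. (norm (x n))\<^sup>2) summable_on range int"
        by (subst summable_on_reindex) (auto simp: o_def intro: summable_nonneg_imp_summable_on)
      have "cosh (pi * (\<omega> * real_of_int (- int n) + k)) = cosh (pi * (\<omega> * real_of_int (int n) + - k))" for n
        by (subst cosh_minus[symmetric]) (simp add: algebra_simps)
      hence "(norm (x (- int n)))\<^sup>2 = 1 / pi * (norm c)\<^sup>2 *
          ((norm (v (int n)))\<^sup>2 * cosh (pi * (\<omega> * real_of_int (int n) + - k)))" for n
        unfolding x2 c by (simp add: norm_mult power_mult_distrib)
      hence "summable (\<lambda>n. (norm (x (- int n)))\<^sup>2)"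
        unfolding v_def by (simp only:) (intro summable_mult jost_summable p)
      thus "(\<lambda>n. (norm (x n))\<^sup>2) summable_on range (\<lambda>n. - int n)"
        by (subst summable_on_reindex) (auto simp: o_def inj_on_def intro: summable_nonneg_imp_summable_on)
    qed
    moreover have "range int \<union> range (\<lambda>n. - int n) = UNIV"
      by (auto intro: int_cases2)
    ultimately have "l2seq x" unfolding l2seq_def by simp
    moreover have "(\<lambda>n. mh_gamma T n k * x n) = u" by (simp add: x_def mh_gamma_nonzero fun_eq_iff)
    ultimately have "x \<in> mh_eigenspace T A k (of_real e)"
      unfolding mh_eigenspace_iff using u by (simp add: \<omega>_def \<mu>_def)
    moreover obtain n where "u n \<noteq> 0" unfolding u_def by (rule jost_nonzero[OF p])
    hence "x n \<noteq> 0" using mh_gamma_nonzero by (simp add: x_def)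
    hence "x \<noteq> (\<lambda>_. 0)" by auto
    ultimately show ?L by blast
  qed
qed

section \<open>Multiplicities\<close>

text \<open>Any two eigenvectors are multiples of one decaying solution, so crossing their factors a
  and b gives a linear relation; independence then forces a = 0 and the first vector to
  vanish.\<close>

lemma mh_mult_le_1:
  assumes "T > 0" "e \<noteq> 0"
  shows "mh_mult T A k (of_real e) \<le> 1"
  unfolding mh_mult_def
proof (rule Sup_least, clarify)
  fix n and v :: "nat \<Rightarrow> int \<Rightarrow> complex"
  assume v: "\<forall>i<n. v i \<in> mh_eigenspace T A k (complex_of_real e)"
    and indep: "\<forall>c. (\<lambda>m. \<Sum>i<n. c i * v i m) = (\<lambda>_. 0) \<longrightarrow> (\<forall>i<n. c i = 0)"
  let ?j = "jost (2 * pi / T) A (e / pi) k"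
  show "enat n \<le> 1"
  proof (rule ccontr)
    assume "\<not> enat n \<le> 1"
    hence n: "n \<ge> 2" by (simp add: one_enat_def)
    have v0: "v 0 \<in> mh_eigenspace T A k (of_real e)" and v1: "v 1 \<in> mh_eigenspace T A k (of_real e)"
      using v n by auto
    obtain a where a: "\<And>m. mh_gamma T m k * v 0 m = a * ?j m"
      using mh_eigenvector_proportional_jost[OF assms v0] by metis
    obtain b where b: "\<And>m. mh_gamma T m k * v 1 m = b * ?j m"
      using mh_eigenvector_proportional_jost[OF assms v1] by metis
    have two: "(\<Sum>i<n. (if i = 0 then s else if i = 1 then t else 0) * v i m) = s * v 0 m + t * v 1 m" for s t m
    proof -
      have "(\<Sum>i<n. (if i = 0 then s else if i = 1 then t else 0) * v i m) =
          (\<Sum>i\<in>{0,1}. (if i = 0 then s else if i = 1 then t else 0) * v i m)"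
        by (rule sum.mono_neutral_right) (use n in auto)
      thus ?thesis by simp
    qed
    have ind: "s = 0 \<and> t = 0" if "\<And>m. s * v 0 m + t * v 1 m = 0" for s t
    proof -
      have "\<forall>i<n. (if i = 0 then s else if i = 1 then t else 0) = 0"
        using indep[THEN spec, of "\<lambda>i. if i = 0 then s else if i = 1 then t else 0"] that
        unfolding two by blast
      from this[rule_format, of 0] this[rule_format, of 1] show ?thesis using n by simp
    qed
    have "b * v 0 m + (- a) * v 1 m = 0" for m
    proof -
      have "mh_gamma T m k * (b * v 0 m + (- a) * v 1 m) = b * (mh_gamma T m k * v 0 m) - a * (mh_gamma T m k * v 1 m)"
        by (simp add: algebra_simps)
      also have "\<dots> = 0" unfolding a b by simp
      finally show ?thesis using mh_gamma_nonzero by simp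
    qed
    from ind[OF this] have "a = 0" by simp
    hence "v 0 m = 0" for m using a[of m] mh_gamma_nonzero[of T m k] by simp
    hence "1 * v 0 m + 0 * v 1 m = 0" for m by simp
    from ind[OF this] show False by simp
  qed
qed

lemma mh_mult_eq_0_iff:
  "mh_mult T A k lam = 0 \<longleftrightarrow> \<not> (\<exists>x\<in>mh_eigenspace T A k lam. x \<noteq> (\<lambda>_. 0))"
proof
  assume 0: "mh_mult T A k lam = 0"
  show "\<not> (\<exists>x\<in>mh_eigenspace T A k lam. x \<noteq> (\<lambda>_. 0))"
  proof
    assume "\<exists>x\<in>mh_eigenspace T A k lam. x \<noteq> (\<lambda>_. 0)"
    then obtain x where x: "x \<in> mh_eigenspace T A k lam" "x \<noteq> (\<lambda>_. 0)" by blast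
    have "enat 1 \<le> mh_mult T A k lam"
      unfolding mh_mult_def
      by (rule Sup_upper, rule CollectI, rule exI[of _ 1], intro conjI refl exI[of _ "\<lambda>_. x"])
        (use x in \<open>auto simp: fun_eq_iff\<close>)
    thus False using 0 by (simp add: enat_0_iff)
  qed
next
  assume no: "\<not> (\<exists>x\<in>mh_eigenspace T A k lam. x \<noteq> (\<lambda>_. 0))"
  have "mh_mult T A k lam \<le> 0"
    unfolding mh_mult_def
  proof (rule Sup_least, clarify)
    fix n and v :: "nat \<Rightarrow> int \<Rightarrow> complex"
    assume v: "\<forall>i<n. v i \<in> mh_eigenspace T A k lam"
      and indep: "\<forall>c. (\<lambda>m. \<Sum>i<n. c i * v i m) = (\<lambda>_. 0) \<longrightarrow> (\<forall>i<n. c i = 0)"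
    have "v i = (\<lambda>_. 0)" if "i < n" for i using v no that by blast
    hence "(\<lambda>m. \<Sum>i<n. 1 * v i m) = (\<lambda>_. 0)" by simp
    hence "\<forall>i<n. (1::complex) = 0" using indep[THEN spec, of "\<lambda>_. 1"] by blast
    thus "enat n \<le> 0" by (cases n) (auto simp: zero_enat_def)
  qed
  thus "mh_mult T A k lam = 0" by simp
qed

section \<open>Identity theorem for real analytic functions\<close>

lemma real_analytic_diff:
  assumes "real_analytic f" "real_analytic g"
  shows "real_analytic (\<lambda>x. f x - g x)"
  unfolding real_analytic_def
proof
  fix x0
  obtain r a where r: "r > 0" "\<And>x. \<bar>x - x0\<bar> < r \<Longrightarrow> (\<lambda>n. a n * (x - x0) ^ n) sums f x"
    using assms(1) unfolding real_analytic_def by metis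
  obtain s b where s: "s > 0" "\<And>x. \<bar>x - x0\<bar> < s \<Longrightarrow> (\<lambda>n. b n * (x - x0) ^ n) sums g x"
    using assms(2) unfolding real_analytic_def by metis
  show "\<exists>r>0. \<exists>a. \<forall>x. \<bar>x - x0\<bar> < r \<longrightarrow> (\<lambda>n. a n * (x - x0) ^ n) sums (f x - g x)"
    by (intro exI[of _ "min r s"] exI[of _ "\<lambda>n. a n - b n"] conjI allI impI)
      (use r(1) s(1) sums_diff[OF r(2) s(2)] in \<open>auto simp: left_diff_distrib\<close>)
qed

text \<open>Either all local Taylor coefficients vanish, or the zeros near the point are
  isolated.\<close>

lemma real_analytic_zeros:
  assumes "real_analytic h"
  shows "eventually (\<lambda>x. h x = 0) (nhds x0) \<or> eventually (\<lambda>x. h x \<noteq> 0) (at x0)"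
proof -
  obtain r a where r: "r > 0" "\<And>x. \<bar>x - x0\<bar> < r \<Longrightarrow> (\<lambda>n. a n * (x - x0) ^ n) sums h x"
    using assms unfolding real_analytic_def by metis
  show ?thesis
  proof (cases "\<forall>n. a n = 0")
    case True
    have "h x = 0" if "dist x x0 < r" for x
      using r(2)[of x] that True sums_unique2[OF _ sums_zero] by (auto simp: dist_real_def)
    thus ?thesis using r(1) by (auto simp: eventually_nhds_metric)
  next
    case False
    then obtain m where m: "a m \<noteq> 0" by blast
    \<comment> \<open>The series is multiplied by x - x0, because \<open>powser_0_nonzero\<close>
      asks for a function vanishing at the centre and a nonzero coefficient of positive
      index.\<close>
    define b where "b = (\<lambda>n. case n of 0 \<Rightarrow> 0 | Suc j \<Rightarrow> a j)"
    have b: "(\<lambda>n. b n * (x - x0) ^ n) sums ((x - x0) * h x)" if "norm (x - x0) < r" for x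
    proof -
      have "(\<lambda>n. (x - x0) * (a n * (x - x0) ^ n)) sums ((x - x0) * h x)"
        using that by (intro sums_mult r) simp
      hence "(\<lambda>n. b (Suc n) * (x - x0) ^ Suc n) sums ((x - x0) * h x)"
        by (simp add: b_def mult_ac)
      thus ?thesis by (subst (asm) sums_Suc_iff) (simp add: b_def)
    qed
    obtain s where "s > 0" and s: "\<And>z. z \<in> cball x0 s - {x0} \<Longrightarrow> (z - x0) * h z \<noteq> 0"
      by (rule powser_0_nonzero[of r x0 b "\<lambda>x. (x - x0) * h x" "Suc m", OF r(1) b])
        (use m in \<open>auto simp: b_def\<close>)
    have "eventually (\<lambda>x. h x \<noteq> 0) (at x0)"
      unfolding eventually_at
    proof (intro exI[of _ s] conjI ballI impI)
      fix x assume "x \<noteq> x0 \<and> dist x x0 < s"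
      thus "h x \<noteq> 0" using s[of x] by (auto simp: dist_commute)
    qed (rule \<open>s > 0\<close>)
    thus ?thesis ..
  qed
qed

text \<open>An uncountable set of reals has a limit point. Near it the difference vanishes
  identically, and the set of points with this property is open and closed.\<close>

lemma real_analytic_eqI:
  assumes "real_analytic f" "real_analytic g" and unc: "uncountable {x. f x = g x}"
  shows "f = g"
proof -
  define h where "h = (\<lambda>x. f x - g x)"
  have h: "real_analytic h" unfolding h_def by (intro real_analytic_diff assms)
  define U where "U = {x. eventually (\<lambda>x. h x = 0) (nhds x)}"
  obtain z where "z islimpt {x. f x = g x}" using no_limpt_imp_countable unc by blast
  hence "\<not> eventually (\<lambda>x. h x \<noteq> 0) (at z)"
    by (simp add: islimpt_iff_eventually h_def)
  hence "z \<in> U" using real_analytic_zeros[OF h, of z] by (simp add: U_def)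
  moreover have "open U"
    unfolding open_subopen[of U]
  proof
    fix x assume "x \<in> U"
    then obtain S where S: "open S" "x \<in> S" "\<forall>y\<in>S. h y = 0" by (auto simp: U_def eventually_nhds)
    hence "S \<subseteq> U" by (auto simp: U_def eventually_nhds)
    thus "\<exists>S. open S \<and> x \<in> S \<and> S \<subseteq> U" using S by blast
  qed
  moreover have "open (- U)"
    unfolding open_subopen[of "- U"]
  proof
    fix x assume "x \<in> - U"
    hence "eventually (\<lambda>y. h y \<noteq> 0) (at x)" using real_analytic_zeros[OF h, of x] by (simp add: U_def)
    then obtain S where S: "open S" "x \<in> S" "\<forall>y\<in>S. y \<noteq> x \<longrightarrow> h y \<noteq> 0"
      by (auto simp: eventually_at_topological)
    have "S \<subseteq> - U"
    proof
      fix y assume y: "y \<in> S"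
      show "y \<in> - U"
      proof (cases "y = x")
        case False
        thus ?thesis using S y by (auto simp: U_def dest: eventually_nhds_x_imp_x)
      qed (use \<open>x \<in> - U\<close> in simp)
    qed
    thus "\<exists>S. open S \<and> x \<in> S \<and> S \<subseteq> - U" using S by blast
  qed
  ultimately have "U = UNIV" using connected_UNIV[where 'a = real] unfolding connected_clopen
    by (auto simp: closed_def)
  hence "h x = 0" for x by (auto simp: U_def set_eq_iff dest: eventually_nhds_x_imp_x)
  thus ?thesis by (simp add: h_def fun_eq_iff)
qed

text \<open>The reals are a countable union of coincidence sets, so one of these is uncountable.
  This turns a pointwise choice of list entry into a single entry.\<close>

lemma countable_analytic_family_cover:
  assumes f: "real_analytic f" and g: "\<And>j. j \<in> J \<Longrightarrow> real_analytic (g j)"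
    and "countable J" and cover: "\<And>x. \<exists>j\<in>J. f x = g j x"
  shows "\<exists>j\<in>J. f = g j"
proof -
  have "(\<Union>j\<in>J. {x. f x = g j x}) = UNIV" using cover by auto
  hence "\<not> countable (\<Union>j\<in>J. {x. f x = g j x})" using uncountable_UNIV_real by simp
  then obtain j where "j \<in> J" "uncountable {x. f x = g j x}" using \<open>countable J\<close> by blast
  thus ?thesis using real_analytic_eqI[OF f g] by blast
qed

lemma real_analytic_reflect:
  assumes "real_analytic f"
  shows "real_analytic (\<lambda>x. f (- x))"
  unfolding real_analytic_def
proof
  fix x0
  obtain r a where r: "r > 0" "\<And>x. \<bar>x - (- x0)\<bar> < r \<Longrightarrow> (\<lambda>n. a n * (x - (- x0)) ^ n) sums f x"
    using assms unfolding real_analytic_def by metis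
  show "\<exists>r>0. \<exists>a. \<forall>x. \<bar>x - x0\<bar> < r \<longrightarrow> (\<lambda>n. a n * (x - x0) ^ n) sums f (- x)"
  proof (intro exI[of _ r] exI[of _ "\<lambda>n. a n * (- 1) ^ n"] conjI allI impI r(1))
    fix x assume "\<bar>x - x0\<bar> < r"
    hence "(\<lambda>n. a n * (- x - (- x0)) ^ n) sums f (- x)" by (intro r(2)) simp
    moreover have "- x - (- x0) = (- 1) * (x - x0)" by simp
    ultimately show "(\<lambda>n. a n * (- 1) ^ n * (x - x0) ^ n) sums f (- x)"
      by (simp only: power_mult_distrib mult.assoc)
  qed
qed

lemma real_analytic_shift:
  assumes "real_analytic f"
  shows "real_analytic (\<lambda>x. f (x + c))"
  unfolding real_analytic_def
proof
  fix x0
  obtain r a where r: "r > 0" "\<And>x. \<bar>x - (x0 + c)\<bar> < r \<Longrightarrow> (\<lambda>n. a n * (x - (x0 + c)) ^ n) sums f x"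
    using assms unfolding real_analytic_def by metis
  have "(\<lambda>n. a n * (x - x0) ^ n) sums f (x + c)" if "\<bar>x - x0\<bar> < r" for x
    using r(2)[of "x + c"] that by simp
  thus "\<exists>r>0. \<exists>a. \<forall>x. \<bar>x - x0\<bar> < r \<longrightarrow> (\<lambda>n. a n * (x - x0) ^ n) sums f (x + c)"
    using r(1) by blast
qed

lemma real_analytic_const: "real_analytic (\<lambda>_. c)"
  unfolding real_analytic_def
proof
  fix x0
  have "(\<lambda>n. (if n = 0 then c else 0) * (x - x0) ^ n) sums c" for x
    using powser_sums_if[of 0 "x - x0"] sums_single[of 0 "\<lambda>n. c * (x - x0) ^ n"]
    by (simp add: if_distrib[of "\<lambda>z. z * _"] cong: if_cong)
  thus "\<exists>r>0. \<exists>a. \<forall>x. \<bar>x - x0\<bar> < r \<longrightarrow> (\<lambda>n. a n * (x - x0) ^ n) sums c"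
    by (intro exI[of _ 1] conjI exI[of _ "\<lambda>n. if n = 0 then c else 0"]) auto
qed

section \<open>Band functions\<close>

lemma mh_band_list_value_iff:
  assumes "T > 0" "mh_band_list T A J E" "e \<noteq> 0"
  shows "(\<exists>i\<in>J. E i k = e) \<longleftrightarrow>
    mh_det (2 * pi / T) A (e / pi) (of_real (exp (- (pi * k)))) = 0"
proof -
  have "complex_of_real e \<noteq> 0" using assms(3) by simp
  hence "ecount {i\<in>J. complex_of_real (E i k) = of_real e} = mh_mult T A k (of_real e)"
    using assms(2) unfolding mh_band_list_def by blast
  moreover have "ecount {i\<in>J. complex_of_real (E i k) = of_real e} = 0 \<longleftrightarrow> \<not> (\<exists>i\<in>J. E i k = e)"
    by (auto simp: ecount_def enat_0_iff dest: not_finite_existsD)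
  ultimately show ?thesis
    using mh_mult_eq_0_iff[of T A k "of_real e"] mh_eigenvector_exists_iff[OF assms(1,3), of A k] by argo
qed

text \<open>Two indices with the same value at k would force an eigenvalue of multiplicity at least
  two, against simplicity.\<close>

lemma mh_band_list_values_distinct:
  assumes "T > 0" "mh_band_list T A J E" and ij: "i \<in> J" "j \<in> J" "E i k = E j k"
  shows "i = j"
proof -
  let ?S = "{l\<in>J. complex_of_real (E l k) = of_real (E i k)}"
  have nz: "E i k \<noteq> 0" using assms(2) ij unfolding mh_band_list_def by blast
  hence "complex_of_real (E i k) \<noteq> 0" by simp
  hence "ecount ?S = mh_mult T A k (of_real (E i k))"
    using assms(2) unfolding mh_band_list_def by blast
  hence "ecount ?S \<le> 1" using mh_mult_le_1[OF assms(1) nz] by simp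
  hence "finite ?S" "card ?S \<le> 1" by (auto simp: ecount_def one_enat_def split: if_splits)
  moreover have "i \<in> ?S" "j \<in> ?S" using ij by auto
  ultimately show ?thesis by (metis (no_types, lifting) card_le_Suc0_iff_eq One_nat_def)
qed

lemma even_periodic_image_half_period:
  fixes f :: "real \<Rightarrow> 'a" and \<omega> :: real
  assumes "\<omega> > 0" and even: "\<And>k. f (- k) = f k" and per: "\<And>k. f (k + \<omega>) = f k"
  shows "f ` {0..\<omega> / 2} = range f"
proof -
  have per_int: "f (k + \<omega> * of_int n) = f k" for k n
  proof (induction n rule: int_induct[of _ 0])
    case (step1 i)
    thus ?case using per[of "k + \<omega> * of_int i"] by (simp add: algebra_simps)
  next
    case (step2 i)
    thus ?case using per[of "k + \<omega> * of_int (i - 1)"] by (simp add: algebra_simps)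
  qed simp
  have "f k \<in> f ` {0..\<omega> / 2}" for k
  proof -
    \<comment> \<open>Subtracting the nearest multiple of the period leaves a remainder of modulus
      at most \<omega>/2; evenness then makes it nonnegative.\<close>
    define t where "t = k - \<omega> * of_int (round (k / \<omega>))"
    have "t = \<omega> * - (of_int (round (k / \<omega>)) - k / \<omega>)"
      using assms(1) by (simp add: t_def field_simps)
    hence "\<bar>t\<bar> = \<omega> * \<bar>of_int (round (k / \<omega>)) - k / \<omega>\<bar>"
      using assms(1) by (simp only: abs_mult abs_minus_cancel abs_of_pos)
    also have "\<dots> \<le> \<omega> * (1 / 2)"
      using assms(1) of_int_round_abs_le[of "k / \<omega>"] by (intro mult_left_mono) auto
    finally have t: "\<bar>t\<bar> \<in> {0..\<omega> / 2}" by simp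
    have "f k = f t" using per_int[of t "round (k / \<omega>)"] by (simp add: t_def)
    also have "\<dots> = f \<bar>t\<bar>" using even[of t] by (simp add: abs_if)
    finally show ?thesis using t by blast
  qed
  thus ?thesis by auto
qed

theorem theorem8p5:
  fixes T A :: real and J :: "nat set" and E :: "nat \<Rightarrow> real \<Rightarrow> real"
  assumes "T > 0" and "mh_band_list T A J E"
  shows "(\<forall>i\<in>J. \<forall>j\<in>J. i \<noteq> j \<longrightarrow>
            (\<forall>k. E i k \<noteq> E j k) \<and>
            E i ` {0..(2 * pi / T) / 2} \<inter> E j ` {0..(2 * pi / T) / 2} = {}) \<and>
         (\<forall>i\<in>J. (\<forall>k. E i (- k) = E i k) \<and> (\<forall>k. E i (k + 2 * pi / T) = E i k) \<and>
            E i ` {0..(2 * pi / T) / 2} = range (E i))"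
proof -
  define \<omega> where "\<omega> = 2 * pi / T"
  have \<omega>: "\<omega> > 0" using assms(1) by (simp add: \<omega>_def)
  have an: "real_analytic (E i)" and nz: "E i k \<noteq> 0" if "i \<in> J" for i k
    using assms(2) that unfolding mh_band_list_def by blast+
  note value_iff = mh_band_list_value_iff[OF assms, folded \<omega>_def]
  note distinct = mh_band_list_values_distinct[OF assms]
  have even: "E i (- k) = E i k" if i: "i \<in> J" for i k
  proof -
    have "\<exists>j\<in>J. E i (- k) = E j k" for k
    proof -
      have "\<exists>j\<in>J. E j k = E i (- k)"
        unfolding value_iff[OF nz[OF i]]
        using value_iff[OF nz[OF i], of "- k" "- k"] i mh_det_reflect_shift(1)[OF \<omega>] by blast
      thus ?thesis by metis
    qed
    then obtain j where j: "j \<in> J" "(\<lambda>k. E i (- k)) = E j"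
      using countable_analytic_family_cover[where g = E and J = J, OF real_analytic_reflect[OF an[OF i]] an countableI_type] by blast
    \<comment> \<open>The point 0 is fixed by reflection, so the reflected band meets
      \<open>E i\<close> there.\<close>
    hence "i = j" using distinct[OF i j(1), of 0] fun_cong[OF j(2), of 0] by simp
    thus ?thesis using fun_cong[OF j(2), of k] by simp
  qed
  have per: "E i (k + \<omega>) = E i k" if i: "i \<in> J" for i k
  proof -
    have "\<exists>j\<in>J. E i (k + \<omega>) = E j k" for k
    proof -
      have "\<exists>j\<in>J. E j k = E i (k + \<omega>)"
        unfolding value_iff[OF nz[OF i]]
        using value_iff[OF nz[OF i], of "k + \<omega>" "k + \<omega>"] i mh_det_reflect_shift(2)[OF \<omega>] by blast
      thus ?thesis by metis
    qed
    then obtain j where j: "j \<in> J" "(\<lambda>k. E i (k + \<omega>)) = E j"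
      using countable_analytic_family_cover[where g = E and J = J, OF real_analytic_shift[OF an[OF i]] an countableI_type] by blast
    \<comment> \<open>Translation by \<omega> carries -\<omega>/2 to \<omega>/2, and evenness of
      \<open>E j\<close> brings both bands to the same point.\<close>
    have "E i (\<omega> / 2) = E j (\<omega> / 2)"
      using fun_cong[OF j(2), of "- (\<omega> / 2)"] even[OF j(1), of "\<omega> / 2"] by simp
    hence "i = j" using distinct[OF i j(1)] by blast
    thus ?thesis using fun_cong[OF j(2), of k] by simp
  qed
  have disjoint: "E i ` {0..\<omega> / 2} \<inter> E j ` {0..\<omega> / 2} = {}" if ij: "i \<in> J" "j \<in> J" "i \<noteq> j" for i j
  proof (rule ccontr)
    assume "E i ` {0..\<omega> / 2} \<inter> E j ` {0..\<omega> / 2} \<noteq> {}"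
    then obtain k1 k2 where k: "k1 \<in> {0..\<omega> / 2}" "k2 \<in> {0..\<omega> / 2}" "E i k1 = E j k2" by blast
    define e where "e = E i k1"
    have e: "e \<noteq> 0" "E i k1 = e" "E j k2 = e" using nz[OF ij(1)] k by (auto simp: e_def)
    have zero: "mh_det \<omega> A (e / pi) (of_real (exp (- (pi * k1)))) = 0"
      "mh_det \<omega> A (e / pi) (of_real (exp (- (pi * k2)))) = 0"
      using value_iff[OF e(1), of k1] value_iff[OF e(1), of k2] e ij by blast+
    have "k1 \<noteq> k2" using distinct[OF ij(1,2), of k1] k(3) ij(3) by auto
    \<comment> \<open>The half period in k corresponds to the fundamental domain in w required by
      \<open>qdet_zero_unique\<close>.\<close>
    have cell: "exp (- (pi * k)) \<le> 1" "exp (- (pi * \<omega>)) \<le> (exp (- (pi * k)))\<^sup>2" if "k \<in> {0..\<omega> / 2}" for k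
      using that by (simp_all flip: exp_double)
    have "mh_det \<omega> A (e / pi) (of_real (exp (- (pi * k)))) = 0" for k
      unfolding mh_det_def
      by (rule qdet_zero_unique[where ?w1.0 = "exp (- (pi * k1))" and ?w2.0 = "exp (- (pi * k2))"])
        (use cell[OF k(1)] cell[OF k(2)] zero \<omega> \<open>k1 \<noteq> k2\<close> in \<open>auto simp: mh_det_def\<close>)
    hence "\<exists>l\<in>J. e = E l k" for k using value_iff[OF e(1), of k] by metis
    \<comment> \<open>The common energy is attained at every k, so the list contains the constant
      band e; this band meets \<open>E i\<close> at \<open>k1\<close> and \<open>E j\<close> at
      \<open>k2\<close>.\<close>
    then obtain l where l: "l \<in> J" "(\<lambda>_. e) = E l"
      using countable_analytic_family_cover[where g = E and J = J, OF real_analytic_const an countableI_type] by blast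
    have El: "E l k = e" for k using fun_cong[OF l(2), of k] by (rule sym)
    have "l = i" by (rule distinct[OF l(1) ij(1), of k1]) (simp only: El e(2))
    moreover have "l = j" by (rule distinct[OF l(1) ij(2), of k2]) (simp only: El e(3))
    ultimately show False using ij(3) by simp
  qed
  show ?thesis
    unfolding \<omega>_def[symmetric]
  proof (intro conjI ballI allI impI)
    fix i j k assume "i \<in> J" "j \<in> J" "i \<noteq> j"
    thus "E i k \<noteq> E j k" using distinct by blast
  next
    fix i j assume "i \<in> J" "j \<in> J" "i \<noteq> j"
    thus "E i ` {0..\<omega> / 2} \<inter> E j ` {0..\<omega> / 2} = {}" by (rule disjoint)
  next
    fix i assume i: "i \<in> J"
    show "E i (- k) = E i k" and "E i (k + \<omega>) = E i k" for k by (rule even[OF i], rule per[OF i])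
    show "E i ` {0..\<omega> / 2} = range (E i)"
      by (rule even_periodic_image_half_period[OF \<omega> even[OF i] per[OF i]])
  qed
qed

end
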